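(* There is a deterministic algorithm which, given a discounted game on a graph with $n$ nodes, finds its vector of values in $n^{O(1)}\cdot (2+\sqrt{2})^n$ time and $n^{O(1)}$ space. The algorithm can be performed even when the discount factor and the edge weights are arbitrary real numbers (assuming basic arithmetic operations with them are carried out by an oracle).
   Context: A discounted game is given by a finite directed graph $G=(V,E)$ in which every node has at least one outgoing edge, a partition $V=V_{\mathrm{Max}}\sqcup V_{\mathrm{Min}}$, a weight function $w\colon E\to\mathbb{R}$ and a discount factor $\lambda\in(0,1)$. The optimality equations for the game are, for $x\in\mathbb{R}^V$: $x_a=\max_{e=(a,b)\in E}\,(w(e)+\lambda x_b)$ for $a\in V_{\mathrm{Max}}$ and $x_a=\min_{e=(a,b)\in E}\,(w(e)+\lambda x_b)$ for $a\in V_{\mathrm{Min}}$. These equations have a unique solution $x^*$, called the vector of values of the game; "finding the values" means computing $x^*$. *)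

theory Defs
  imports "HOL-Analysis.Analysis"
begin

section \<open>Discounted games\<close>

text \<open>A game on \<open>n\<close> nodes has the node set \<open>{..<n}\<close>: an algorithm receives its graph with the nodes
  numbered. The nodes of Min are those that do not belong to Max. The function \<open>weight\<close> matters
  on edges only.\<close>

record dgame =
  num_nodes :: nat
  max_nodes :: "nat set"
  edges :: "(nat \<times> nat) set"
  weight :: "nat \<times> nat \<Rightarrow> real"
  discount :: real

definition nodes :: "dgame \<Rightarrow> nat set" where
  "nodes G = {..<num_nodes G}"

definition min_nodes :: "dgame \<Rightarrow> nat set" where
  "min_nodes G = nodes G - max_nodes G"

definition discounted_game :: "dgame \<Rightarrow> bool" where
  "discounted_game G \<longleftrightarrow>
     edges G \<subseteq> nodes G \<times> nodes G \<and>
     (\<forall>a\<in>nodes G. \<exists>b. (a, b) \<in> edges G) \<and>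
     max_nodes G \<subseteq> nodes G \<and>
     0 < discount G \<and> discount G < 1"

definition options :: "dgame \<Rightarrow> (nat \<Rightarrow> real) \<Rightarrow> nat \<Rightarrow> real set" where
  "options G x a = (\<lambda>b. weight G (a, b) + discount G * x b) ` {b. (a, b) \<in> edges G}"

definition optimality_equations :: "dgame \<Rightarrow> (nat \<Rightarrow> real) \<Rightarrow> bool" where
  "optimality_equations G x \<longleftrightarrow>
     (\<forall>a\<in>max_nodes G. x a = Max (options G x a)) \<and>
     (\<forall>a\<in>min_nodes G. x a = Min (options G x a))"

text \<open>A vector indexed by the nodes is a function that vanishes outside of the node set.\<close>

definition value_vector :: "dgame \<Rightarrow> nat \<Rightarrow> real" where
  "value_vector G = (THE x. optimality_equations G x \<and> (\<forall>a. a \<notin> nodes G \<longrightarrow> x a = 0))"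

lemma Max_image_diff_le:
  fixes f g :: "'a \<Rightarrow> real"
  assumes "finite S" "S \<noteq> {}" "\<And>b. b \<in> S \<Longrightarrow> f b \<le> g b + d"
  shows "Max (f ` S) \<le> Max (g ` S) + d"
proof -
  have "f b \<le> Max (g ` S) + d" if "b \<in> S" for b
  proof -
    have "g b \<le> Max (g ` S)" using that assms(1) by simp
    then show ?thesis using assms(3)[OF that] by linarith
  qed
  then show ?thesis using assms(1,2) by (subst Max_le_iff) auto
qed

lemma Min_image_diff_le:
  fixes f g :: "'a \<Rightarrow> real"
  assumes "finite S" "S \<noteq> {}" "\<And>b. b \<in> S \<Longrightarrow> f b \<le> g b + d"
  shows "Min (f ` S) \<le> Min (g ` S) + d"
proof -
  have "Min (f ` S) - d \<le> g b" if "b \<in> S" for b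
  proof -
    have "Min (f ` S) \<le> f b" using that assms(1) by simp
    then show ?thesis using assms(3)[OF that] by linarith
  qed
  then have "Min (f ` S) - d \<le> Min (g ` S)" using assms(1,2) by (subst Min_ge_iff) auto
  then show ?thesis by linarith
qed

lemma value_vector_ex1:
  assumes G: "discounted_game G"
  shows "\<exists>!x. optimality_equations G x \<and> (\<forall>a. a \<notin> nodes G \<longrightarrow> x a = 0)"
proof -
  let ?l = "discount G"
  define T where "T x a = (if a \<in> max_nodes G then Max (options G x a)
      else if a \<in> nodes G then Min (options G x a) else 0)" for x a
  have l: "0 < ?l" "?l < 1" and mx: "max_nodes G \<subseteq> nodes G"
    using G by (auto simp: discounted_game_def)
  have T_fix: "optimality_equations G x \<and> (\<forall>a. a \<notin> nodes G \<longrightarrow> x a = 0) \<longleftrightarrow> T x = x" for x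
  proof -
    have "T x = x \<longleftrightarrow> (\<forall>a. T x a = x a)" by (rule fun_eq_iff)
    also have "\<dots> \<longleftrightarrow> (\<forall>a. (a \<in> max_nodes G \<longrightarrow> Max (options G x a) = x a) \<and>
        (a \<notin> max_nodes G \<longrightarrow> a \<in> nodes G \<longrightarrow> Min (options G x a) = x a) \<and>
        (a \<notin> nodes G \<longrightarrow> 0 = x a))"
      by (intro iff_allI) (use mx in \<open>auto simp only: T_def if_True if_False split: if_split\<close>)
    finally show ?thesis
      unfolding optimality_equations_def min_nodes_def by (auto simp only: eq_commute Diff_iff)
  qed
  have fin: "finite {b. (a, b) \<in> edges G}" for a
    by (rule finite_subset[of _ "nodes G"]) (use G in \<open>auto simp: discounted_game_def nodes_def\<close>)
  have ne: "{b. (a, b) \<in> edges G} \<noteq> {}" if "a \<in> nodes G" for a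
    using G that by (auto simp: discounted_game_def)
  have T_le: "T x a \<le> T y a + ?l * d" if "\<And>b. x b \<le> y b + d" "0 \<le> d" for x y d a
  proof -
    have *: "weight G (a, b) + ?l * x b \<le> weight G (a, b) + ?l * y b + ?l * d" for b
      using mult_left_mono[OF that(1), of ?l b] l by (simp add: algebra_simps)
    have **: "0 \<le> ?l * d" using l that(2) by simp
    have mx': "Max (options G x a) \<le> Max (options G y a) + ?l * d" if "a \<in> nodes G"
      unfolding options_def by (rule Max_image_diff_le[OF fin ne[OF that] *])
    have mn': "Min (options G x a) \<le> Min (options G y a) + ?l * d" if "a \<in> nodes G"
      unfolding options_def by (rule Min_image_diff_le[OF fin ne[OF that] *])
    consider "a \<in> max_nodes G" "a \<in> nodes G" | "a \<notin> max_nodes G" "a \<in> nodes G"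
      | "a \<notin> max_nodes G" "a \<notin> nodes G" using mx by blast
    then show ?thesis
      by cases (simp_all only: T_def if_True if_False mx' mn' ** add_0)
  qed
  have T_dist: "\<bar>T x a - T y a\<bar> \<le> ?l * d" if "\<And>b. \<bar>x b - y b\<bar> \<le> d" for x y d a
  proof -
    have "x b \<le> y b + d" "y b \<le> x b + d" for b
      using that[of b] by linarith+
    moreover have "0 \<le> d" using that[of 0] by linarith
    ultimately have "T x a \<le> T y a + ?l * d" "T y a \<le> T x a + ?l * d"
      by (simp_all only: T_le)
    then show ?thesis by linarith
  qed
  have T_0: "T x a = 0" if "a \<notin> nodes G" for x a
    using that mx by (auto simp: T_def)
  have bound: "\<exists>d\<ge>0. \<forall>a. \<bar>h a\<bar> \<le> d" if "\<And>a. a \<notin> nodes G \<Longrightarrow> h a = 0" for h :: "nat \<Rightarrow> real"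
  proof (intro exI conjI allI)
    show "0 \<le> (\<Sum>b\<in>nodes G. \<bar>h b\<bar>)" by (simp add: sum_nonneg)
    show "\<bar>h a\<bar> \<le> (\<Sum>b\<in>nodes G. \<bar>h b\<bar>)" for a
    proof (cases "a \<in> nodes G")
      case True
      then show ?thesis
        by (intro member_le_sum[of a "nodes G" "\<lambda>b. \<bar>h b\<bar>"]) (auto simp: nodes_def)
    next
      case False
      then show ?thesis by (simp add: that sum_nonneg)
    qed
  qed
  have uniq: "x = y" if x: "T x = x" and y: "T y = y" for x y
  proof
    fix a
    obtain d where d: "0 \<le> d" "\<bar>x b - y b\<bar> \<le> d" for b
      using bound[of "\<lambda>b. x b - y b"] T_0[of _ x] T_0[of _ y] x y by auto
    have le: "\<bar>x b - y b\<bar> \<le> ?l ^ k * d" for k b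
    proof (induction k arbitrary: b)
      case (Suc k)
      have "\<bar>T x b - T y b\<bar> \<le> ?l * (?l ^ k * d)" by (rule T_dist) (rule Suc.IH)
      then show ?case using x y by (simp add: mult.assoc)
    qed (simp add: d)
    have "(\<lambda>k. ?l ^ k * d) \<longlonglongrightarrow> 0 * d"
      using l by (intro tendsto_mult LIMSEQ_realpow_zero tendsto_const) auto
    then have "\<bar>x a - y a\<bar> \<le> 0 * d"
      by (rule LIMSEQ_le_const) (use le in blast)
    then show "x a = y a" by simp
  qed
  define X where "X k = (T ^^ k) (\<lambda>_. 0)" for k
  have X_Suc: "X (Suc k) = T (X k)" for k by (simp add: X_def)
  have X_0: "X k a = 0" if "a \<notin> nodes G" for k a
    by (cases k) (use T_0[OF that] in \<open>simp_all add: X_def\<close>)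
  obtain d where d: "0 \<le> d" "\<bar>X 1 a - X 0 a\<bar> \<le> d" for a
    using bound[of "\<lambda>b. X 1 b - X 0 b"] X_0 by auto
  have step: "\<bar>X (Suc k) a - X k a\<bar> \<le> ?l ^ k * d" for k a
  proof (induction k arbitrary: a)
    case (Suc k)
    have "\<bar>T (X (Suc k)) a - T (X k) a\<bar> \<le> ?l * (?l ^ k * d)" by (rule T_dist) (rule Suc.IH)
    then show ?case by (simp add: mult.assoc X_Suc)
  qed (use d in simp)
  have "\<exists>L. (\<lambda>k. X k a) \<longlonglongrightarrow> L" for a
  proof -
    have "summable (\<lambda>k. X (Suc k) a - X k a)"
    proof (rule summable_comparison_test')
      show "summable (\<lambda>k. ?l ^ k * d)" using l by (intro summable_mult2 summable_geometric) auto
      show "norm (X (Suc k) a - X k a) \<le> ?l ^ k * d" for k using step by simp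
    qed
    then have "convergent (\<lambda>k. \<Sum>i<k. X (Suc i) a - X i a)"
      by (simp add: summable_iff_convergent)
    then have "convergent (\<lambda>k. X k a - X 0 a)"
      by (simp only: sum_lessThan_telescope[of "\<lambda>i. X i a"])
    then show ?thesis by (simp add: convergent_def X_def)
  qed
  then obtain L where L: "\<And>a. (\<lambda>k. X k a) \<longlonglongrightarrow> L a" by metis
  have L_0: "L a = 0" if "a \<notin> nodes G" for a
    using L[of a] by (simp add: X_0[OF that] LIMSEQ_const_iff)
  have "T L = L"
  proof
    fix a
    have "(\<lambda>k. X (Suc k) a) \<longlonglongrightarrow> T L a"
    proof (rule LIMSEQ_I)
      fix e :: real assume e: "0 < e"
      have "\<forall>\<^sub>F k in sequentially. \<forall>b\<in>nodes G. \<bar>X k b - L b\<bar> < e"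
        by (rule eventually_ball_finite)
          (use L e in \<open>auto simp: nodes_def tendsto_iff dist_real_def\<close>)
      then obtain N where N: "\<And>k b. k \<ge> N \<Longrightarrow> b \<in> nodes G \<Longrightarrow> \<bar>X k b - L b\<bar> < e"
        by (auto simp: eventually_sequentially)
      have "norm (X (Suc k) a - T L a) < e" if k: "k \<ge> N" for k
      proof -
        have "\<bar>X k b - L b\<bar> \<le> e" for b
          using N[OF k, of b] e by (cases "b \<in> nodes G") (simp_all add: X_0 L_0)
        then have "\<bar>T (X k) a - T L a\<bar> \<le> ?l * e" by (rule T_dist)
        also have "\<dots> < e" using l e by simp
        finally show ?thesis by (simp add: X_Suc)
      qed
      then show "\<exists>N. \<forall>k\<ge>N. norm (X (Suc k) a - T L a) < e" by blast
    qed
    moreover have "(\<lambda>k. X (Suc k) a) \<longlonglongrightarrow> L a" using L by (rule LIMSEQ_Suc)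
    ultimately show "T L a = L a" by (rule LIMSEQ_unique)
  qed
  with uniq have "\<exists>!x. T x = x" by blast
  then show ?thesis by (simp only: T_fix)
qed


section \<open>A real random-access machine\<close>

text \<open>The programs are while programs over a memory that has integer cells and real cells. A cell is
  addressed by the number of an array, which is fixed by the program text, and by a row and a column,
  which are computed at run time (indirect addressing).

  Arithmetic operations and comparisons on reals take unit time, and a real cell takes unit space.
  The only real constants are 0 and 1, so that a program cannot hide information in a constant.
  Division is total with \<open>x / 0 = 0\<close>.

  Integers can only be incremented and decremented (with \<open>0\<close> staying \<open>0\<close>). Hence they exceed the
  integers of the input by at most the running time (lemma \<open>exec_imem_le\<close>), and if the running time is
  \<open>2\<close> to a polynomial, an integer cell has polynomially many bits. So counting cells, as
  we do here, is a sound measure of space up to a polynomial factor.\<close>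

type_synonym addr = "nat \<times> nat \<times> nat"

record state =
  imem :: "addr \<Rightarrow> nat"
  rmem :: "addr \<Rightarrow> real"

datatype cell = Int_Cell addr | Real_Cell addr

datatype iexp =
    IZero
  | ISuc iexp
  | IPred iexp
  | IGet nat iexp iexp

datatype rexp =
    RZero
  | ROne
  | RGet nat iexp iexp
  | RAdd rexp rexp
  | RSub rexp rexp
  | RMul rexp rexp
  | RDiv rexp rexp

datatype bexp =
    ILess iexp iexp
  | RLess rexp rexp
  | BNot bexp
  | BAnd bexp bexp

datatype com =
    Skip
  | ISet nat iexp iexp iexp
  | RSet nat iexp iexp rexp
  | Seq com com
  | Cond bexp com com
  | While bexp com

subsection \<open>Values of expressions\<close>

fun ival :: "iexp \<Rightarrow> state \<Rightarrow> nat" where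
  "ival IZero s = 0"
| "ival (ISuc e) s = Suc (ival e s)"
| "ival (IPred e) s = ival e s - 1"
| "ival (IGet A e f) s = imem s (A, ival e s, ival f s)"

fun rval :: "rexp \<Rightarrow> state \<Rightarrow> real" where
  "rval RZero s = 0"
| "rval ROne s = 1"
| "rval (RGet A e f) s = rmem s (A, ival e s, ival f s)"
| "rval (RAdd p q) s = rval p s + rval q s"
| "rval (RSub p q) s = rval p s - rval q s"
| "rval (RMul p q) s = rval p s * rval q s"
| "rval (RDiv p q) s = rval p s / rval q s"

fun bval :: "bexp \<Rightarrow> state \<Rightarrow> bool" where
  "bval (ILess e f) s \<longleftrightarrow> ival e s < ival f s"
| "bval (RLess p q) s \<longleftrightarrow> rval p s < rval q s"
| "bval (BNot b) s \<longleftrightarrow> \<not> bval b s"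
| "bval (BAnd b c) s \<longleftrightarrow> bval b s \<and> bval c s"

subsection \<open>Time to evaluate expressions\<close>

fun itime :: "iexp \<Rightarrow> nat" where
  "itime IZero = 1"
| "itime (ISuc e) = itime e + 1"
| "itime (IPred e) = itime e + 1"
| "itime (IGet A e f) = itime e + itime f + 1"

fun rtime :: "rexp \<Rightarrow> nat" where
  "rtime RZero = 1"
| "rtime ROne = 1"
| "rtime (RGet A e f) = itime e + itime f + 1"
| "rtime (RAdd p q) = rtime p + rtime q + 1"
| "rtime (RSub p q) = rtime p + rtime q + 1"
| "rtime (RMul p q) = rtime p + rtime q + 1"
| "rtime (RDiv p q) = rtime p + rtime q + 1"

fun btime :: "bexp \<Rightarrow> nat" where
  "btime (ILess e f) = itime e + itime f + 1"
| "btime (RLess p q) = rtime p + rtime q + 1"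
| "btime (BNot b) = btime b + 1"
| "btime (BAnd b c) = btime b + btime c + 1"

subsection \<open>Cells read by the evaluation of expressions\<close>

fun icells :: "iexp \<Rightarrow> state \<Rightarrow> cell set" where
  "icells IZero s = {}"
| "icells (ISuc e) s = icells e s"
| "icells (IPred e) s = icells e s"
| "icells (IGet A e f) s = insert (Int_Cell (A, ival e s, ival f s)) (icells e s \<union> icells f s)"

fun rcells :: "rexp \<Rightarrow> state \<Rightarrow> cell set" where
  "rcells RZero s = {}"
| "rcells ROne s = {}"
| "rcells (RGet A e f) s = insert (Real_Cell (A, ival e s, ival f s)) (icells e s \<union> icells f s)"
| "rcells (RAdd p q) s = rcells p s \<union> rcells q s"
| "rcells (RSub p q) s = rcells p s \<union> rcells q s"
| "rcells (RMul p q) s = rcells p s \<union> rcells q s"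
| "rcells (RDiv p q) s = rcells p s \<union> rcells q s"

fun bcells :: "bexp \<Rightarrow> state \<Rightarrow> cell set" where
  "bcells (ILess e f) s = icells e s \<union> icells f s"
| "bcells (RLess p q) s = rcells p s \<union> rcells q s"
| "bcells (BNot b) s = bcells b s"
| "bcells (BAnd b c) s = bcells b s \<union> bcells c s"

subsection \<open>Execution\<close>

text \<open>\<open>exec c s \<tau> F t\<close>: started in \<open>s\<close>, the program \<open>c\<close> halts in \<open>t\<close> after \<open>\<tau>\<close> time units, and \<open>F\<close> is
  the set of all memory cells read or written on the way.\<close>

inductive exec :: "com \<Rightarrow> state \<Rightarrow> nat \<Rightarrow> cell set \<Rightarrow> state \<Rightarrow> bool" where
  Skip: "exec Skip s 1 {} s"
| ISet: "p = (A, ival e s, ival f s) \<Longrightarrow>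
    exec (ISet A e f g) s (itime e + itime f + itime g + 1)
      (insert (Int_Cell p) (icells e s \<union> icells f s \<union> icells g s))
      (s\<lparr>imem := (imem s)(p := ival g s)\<rparr>)"
| RSet: "p = (A, ival e s, ival f s) \<Longrightarrow>
    exec (RSet A e f q) s (itime e + itime f + rtime q + 1)
      (insert (Real_Cell p) (icells e s \<union> icells f s \<union> rcells q s))
      (s\<lparr>rmem := (rmem s)(p := rval q s)\<rparr>)"
| Seq: "exec c s m E s' \<Longrightarrow> exec d s' n F t \<Longrightarrow> exec (Seq c d) s (m + n) (E \<union> F) t"
| Cond_True: "bval b s \<Longrightarrow> exec c s m E t \<Longrightarrow>
    exec (Cond b c d) s (btime b + m + 1) (bcells b s \<union> E) t"
| Cond_False: "\<not> bval b s \<Longrightarrow> exec d s m E t \<Longrightarrow>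
    exec (Cond b c d) s (btime b + m + 1) (bcells b s \<union> E) t"
| While_False: "\<not> bval b s \<Longrightarrow> exec (While b c) s (btime b + 1) (bcells b s) s"
| While_True: "bval b s \<Longrightarrow> exec c s m E s' \<Longrightarrow> exec (While b c) s' n F t \<Longrightarrow>
    exec (While b c) s (btime b + m + n + 1) (bcells b s \<union> E \<union> F) t"

lemma exec_deterministic:
  "exec c s m E t \<Longrightarrow> exec c s m' E' t' \<Longrightarrow> m' = m \<and> E' = E \<and> t' = t"
proof (induction arbitrary: m' E' t' rule: exec.induct)
  case (Seq c s m E s' d n F t)
  from Seq.prems show ?case
    by (cases rule: exec.cases) (use Seq.IH in blast)+
next
  case (While_True b s c m E s' n F t)
  from While_True.prems show ?case
    by (cases rule: exec.cases) (use While_True.IH While_True.hyps in blast)+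
next
  case (Cond_True b s c m E t d)
  from Cond_True.prems show ?case
    by (cases rule: exec.cases) (use Cond_True.IH Cond_True.hyps in blast)+
next
  case (Cond_False b s d m E t c)
  from Cond_False.prems show ?case
    by (cases rule: exec.cases) (use Cond_False.IH Cond_False.hyps in blast)+
qed (erule exec.cases; simp)+

lemma finite_icells: "finite (icells e s)"
  by (induction e) auto

lemma finite_rcells: "finite (rcells p s)"
  by (induction p) (auto simp: finite_icells)

lemma finite_bcells: "finite (bcells b s)"
  by (induction b) (auto simp: finite_icells finite_rcells)

lemma exec_finite: "exec c s m F t \<Longrightarrow> finite F"
  by (induction rule: exec.induct) (auto simp: finite_icells finite_rcells finite_bcells)

lemma ival_le:
  assumes "\<And>p. imem s p \<le> B"
  shows "ival e s \<le> B + itime e"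
proof (induction e)
  case (IGet A e f)
  show ?case using assms[of "(A, ival e s, ival f s)"] by simp
qed auto

lemma exec_imem_le:
  "exec c s m F t \<Longrightarrow> (\<And>p. imem s p \<le> B) \<Longrightarrow> imem t p \<le> B + m"
proof (induction arbitrary: B p rule: exec.induct)
  case (ISet q A e s f g)
  have "ival g s \<le> B + itime g" using ISet by (intro ival_le) auto
  then show ?case using ISet.prems[of p] by (auto simp: trans_le_add1)
next
  case (Seq c s m E s' d n F t)
  from Seq.IH(2)[of "B + m" p] Seq.IH(1)[of B] Seq.prems show ?case by (auto simp: add.assoc)
next
  case (While_True b s c m E s' n F t)
  have "imem t p \<le> (B + m) + n" using While_True.IH While_True.prems by blast
  then show ?case by simp
next
  case (Cond_True b s c m E t d)
  have "imem t p \<le> B + m" using Cond_True.IH Cond_True.prems by blast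
  then show ?case by simp
next
  case (Cond_False b s d m E t c)
  have "imem t p \<le> B + m" using Cond_False.IH Cond_False.prems by blast
  then show ?case by simp
next
  case (Skip s)
  then show ?case by (simp only: trans_le_add1)
next
  case (RSet q A e s f r)
  then show ?case by (simp add: trans_le_add1 del: add_Suc_right One_nat_def split_paired_All split_paired_all)
next
  case (While_False b s c)
  then show ?case by (simp only: trans_le_add1)
qed


section \<open>Input and output\<close>

text \<open>The number of nodes, the owners of the nodes and the adjacency matrix are given in the integer
  arrays 0, 1, 2, the discount factor and the weights of the edges in the real arrays 0, 1. All
  other cells are 0. The output is the column 0 of the real array 2.\<close>

definition game_input :: "dgame \<Rightarrow> state" where
  "game_input G =
    \<lparr>imem = (\<lambda>(A, a, b).
        if A = 0 \<and> a = 0 \<and> b = 0 then num_nodes G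
        else if A = 1 \<and> a \<in> max_nodes G \<and> b = 0 then 1
        else if A = 2 \<and> (a, b) \<in> edges G then 1
        else 0),
     rmem = (\<lambda>(A, a, b).
        if A = 0 \<and> a = 0 \<and> b = 0 then discount G
        else if A = 1 \<and> (a, b) \<in> edges G then weight G (a, b)
        else 0)\<rparr>"

definition game_output :: "state \<Rightarrow> nat \<Rightarrow> real" where
  "game_output t a = rmem t (2, a, 0)"

end

theory Submission
  imports Defs
begin

text \<open>Relax the optimality equations to the polyhedron \<open>x a \<ge> w (a, b) + \<lambda> x b\<close> at nodes of Max and
  \<open>x a \<le> w (a, b) + \<lambda> x b\<close> at nodes of Min; a point solves the equations if every node has a tight
  edge. From a point of the polyhedron, solve the auxiliary game on the tight edges in which a player
  who cannot move pays 1, discounted by \<open>\<lambda>\<close>, and move as far as possible along its vector of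
  values, the shift. All values of the auxiliary game are \<open>0\<close> or \<open>\<plusminus>\<lambda> ^ k\<close>. For every level \<open>k\<close>,
  count the nodes whose owner gains \<open>\<lambda> ^ k\<close> and the nodes whose owner loses \<open>\<lambda> ^ k\<close>. At the first
  level where a move changes something, the former number does not decrease, the latter does not
  increase, and one of them changes. So no sequence of pairs of counts repeats, and there are at most
  \<open>(n + 1) (2 + sqrt 2) ^ n\<close> such sequences.\<close>

section \<open>Level profiles\<close>

text \<open>The shift is a velocity under which no tight inequality breaks and the tight edges that
  realise it stay tight. The payment of 1 makes a node without a tight edge drift against its owner,
  so the move can be unbounded only if every node has a tight edge, that is, at the solution. Two
  points shape the proof. Value iteration in general only converges, but here round
  \<open>t + 1\<close> settles the nodes of level \<open>t\<close> for good, so \<open>n\<close>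
  rounds give the exact shift. And no level before the last occupied one is empty, so a sequence of
  counts uses up nodes at every step: a first level with \<open>m\<close> nodes splits into gains
  and losses in \<open>m + 1\<close> ways and leaves \<open>n - m\<close> nodes. With
  \<open>z = 1 / (2 + sqrt 2)\<close> the weights \<open>(m + 1) * z ^ m\<close> for
  \<open>m \<ge> 1\<close> sum to \<open>1 / (1 - z)^2 - 1 = 1\<close>, hence the base. Neither the
  discount factor nor the size of the weights enters a bound, which is why arbitrary reals are
  allowed.\<close>

definition profiles :: "nat \<Rightarrow> (nat \<Rightarrow> nat \<times> nat) set" where
  "profiles n = {p. (\<forall>k. p k = (0, 0) \<longrightarrow> p (Suc k) = (0, 0)) \<and>
     (\<forall>m. (\<Sum>k<m. fst (p k) + snd (p k)) \<le> n)}"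

text \<open>Lexicographic in the level, with pairs ordered by more gains and fewer losses. The order
  is only partial; \<open>rank\<close> turns it into a number.\<close>

definition profile_less :: "(nat \<Rightarrow> nat \<times> nat) \<Rightarrow> (nat \<Rightarrow> nat \<times> nat) \<Rightarrow> bool" where
  "profile_less p p' \<longleftrightarrow> (\<exists>k. (\<forall>j<k. p j = p' j) \<and> p k \<noteq> p' k \<and>
     fst (p k) \<le> fst (p' k) \<and> snd (p' k) \<le> snd (p k))"

lemma profile_less_irrefl: "\<not> profile_less p p"
  by (simp add: profile_less_def)

lemma profile_less_trans:
  assumes "profile_less p p'" "profile_less p' p''"
  shows "profile_less p p''"
proof -
  obtain k where k: "\<forall>j<k. p j = p' j" "p k \<noteq> p' k" "fst (p k) \<le> fst (p' k)" "snd (p' k) \<le> snd (p k)"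
    using assms(1) by (auto simp: profile_less_def)
  obtain m where m: "\<forall>j<m. p' j = p'' j" "p' m \<noteq> p'' m" "fst (p' m) \<le> fst (p'' m)"
    "snd (p'' m) \<le> snd (p' m)"
    using assms(2) by (auto simp: profile_less_def)
  consider "k < m" | "m < k" | "k = m" by linarith
  then show ?thesis
  proof cases
    case 1
    then show ?thesis unfolding profile_less_def
      by (intro exI[of _ k]) (use k m(1) in auto)
  next
    case 2
    then show ?thesis unfolding profile_less_def
      by (intro exI[of _ m]) (use k(1) m in auto)
  next
    case 3
    \<comment> \<open>First components grow and second ones shrink along both steps, so
      \<open>p k = p'' k\<close> would squeeze \<open>p' k\<close> to the same pair.\<close>
    then have "p k \<noteq> p'' k"
      using k(2-4) m(2-4) by (auto simp: prod_eq_iff)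
    then show ?thesis unfolding profile_less_def
      by (intro exI[of _ k]) (use 3 k m in auto)
  qed
qed

text \<open>Split off level 0: if it holds \<open>m\<close> nodes, \<open>i\<close> of them gaining,
  the rest is a profile of \<open>n - m\<close> nodes. If it is empty, the no-gap condition empties
  all levels; so \<open>m \<ge> 1\<close> otherwise, and the recursion is well-founded.\<close>

lemma profiles_subset:
  "profiles n \<subseteq> insert (\<lambda>_. (0, 0))
     (\<Union>m\<in>{1..n}. \<Union>i\<in>{..m}. (\<lambda>p. case_nat (i, m - i) p) ` profiles (n - m))"
proof
  fix p assume p: "p \<in> profiles n"
  then have p0: "p k = (0, 0) \<Longrightarrow> p (Suc k) = (0, 0)" for k
    by (simp add: profiles_def)
  have ps: "(\<Sum>k<m. fst (p k) + snd (p k)) \<le> n" for m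
    using p by (simp add: profiles_def)
  show "p \<in> insert (\<lambda>_. (0, 0))
     (\<Union>m\<in>{1..n}. \<Union>i\<in>{..m}. (\<lambda>p. case_nat (i, m - i) p) ` profiles (n - m))"
  proof (cases "p 0 = (0, 0)")
    case True
    have "p k = (0, 0)" for k
      by (induction k) (use True p0 in auto)
    then show ?thesis by auto
  next
    case False
    define i m where "i = fst (p 0)" and "m = fst (p 0) + snd (p 0)"
    have mn: "m \<in> {1..n}" using False ps[of 1] by (cases "p 0") (auto simp: m_def)
    have im: "i \<in> {..m}" by (simp add: i_def m_def)
    have "p = case_nat (i, m - i) (\<lambda>k. p (Suc k))"
      by (auto simp: fun_eq_iff i_def m_def split: nat.split)
    moreover have "(\<lambda>k. p (Suc k)) \<in> profiles (n - m)"
    proof -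
      have "(\<Sum>k<j. fst (p (Suc k)) + snd (p (Suc k))) \<le> n - m" for j
        using ps[of "Suc j"]
        by (simp add: sum.lessThan_Suc_shift m_def le_diff_conv2 del: sum.lessThan_Suc)
      then show ?thesis using p0 by (simp add: profiles_def)
    qed
    ultimately show ?thesis using mn im by blast
  qed
qed

lemma finite_profiles: "finite (profiles n)"
proof (induction n rule: less_induct)
  case (less n)
  show ?case
    by (rule finite_subset[OF profiles_subset]) (auto intro!: less)
qed

lemma card_profiles_le: "card (profiles n) \<le> 1 + (\<Sum>m=1..n. (m + 1) * card (profiles (n - m)))"
proof -
  let ?B = "\<lambda>m. \<Union>i\<in>{..m}. (\<lambda>p. case_nat (i, m - i) p) ` profiles (n - m)"
  have B: "card (?B m) \<le> (m + 1) * card (profiles (n - m))" for m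
  proof -
    have "card (?B m) \<le> (\<Sum>i\<in>{..m}. card ((\<lambda>p. case_nat (i, m - i) p) ` profiles (n - m)))"
      by (rule card_UN_le) simp
    also have "\<dots> \<le> (\<Sum>i\<in>{..m}. card (profiles (n - m)))"
      by (intro sum_mono card_image_le finite_profiles)
    finally show ?thesis by simp
  qed
  have "card (profiles n) \<le> card (insert (\<lambda>_. (0, 0)) (\<Union>m\<in>{1..n}. ?B m))"
    by (intro card_mono profiles_subset) (simp add: finite_profiles)
  also have "\<dots> \<le> 1 + card (\<Union>m\<in>{1..n}. ?B m)"
    by (simp add: card_insert_if finite_profiles)
  also have "card (\<Union>m\<in>{1..n}. ?B m) \<le> (\<Sum>m\<in>{1..n}. card (?B m))"
    by (rule card_UN_le) simp
  also have "\<dots> \<le> (\<Sum>m=1..n. (m + 1) * card (profiles (n - m)))"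
    by (intro sum_mono B)
  finally show ?thesis by simp
qed

text \<open>The base \<open>\<beta> = 2 + sqrt 2\<close> is the solution of \<open>(\<Sum>m\<ge>1. (m + 1) / \<beta> ^ m) = 1\<close>.\<close>

lemma sum_Suc_div_power_le_one: "(\<Sum>m=1..n. (real m + 1) / (2 + sqrt 2) ^ m) \<le> 1"
proof -
  let ?\<beta> = "2 + sqrt 2 :: real"
  have pos: "0 < ?\<beta>" by (simp add: add_pos_nonneg)
  \<comment> \<open>The subtracted fraction is the tail of the series. The recursion
    \<open>key\<close> for its numerator rests on
    \<open>(sqrt 2 - 1) * (2 + sqrt 2) = sqrt 2\<close>.\<close>
  have "(\<Sum>m=1..n. (real m + 1) / ?\<beta> ^ m) = 1 - (1 + real n * (sqrt 2 - 1)) / ?\<beta> ^ n"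
  proof (induction n)
    case (Suc n)
    have key: "(1 + real n * (sqrt 2 - 1)) * ?\<beta>
        = (real (Suc n) + 1) + (1 + real (Suc n) * (sqrt 2 - 1))"
      by (simp add: algebra_simps)
    have "(1 + real n * (sqrt 2 - 1)) / ?\<beta> ^ n
        = ((1 + real n * (sqrt 2 - 1)) * ?\<beta>) / ?\<beta> ^ Suc n"
      using pos by simp
    also have "\<dots> = (real (Suc n) + 1) / ?\<beta> ^ Suc n
        + (1 + real (Suc n) * (sqrt 2 - 1)) / ?\<beta> ^ Suc n"
      by (simp only: key add_divide_distrib)
    finally show ?case using Suc.IH by simp
  qed simp
  moreover have "0 \<le> (1 + real n * (sqrt 2 - 1)) / ?\<beta> ^ n" using pos by simp
  ultimately show ?thesis by linarith
qed

text \<open>The factor \<open>n + 1\<close> absorbs the summand 1 of the recursion: for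
  \<open>m \<ge> 1\<close> the induction hypothesis has a factor of at most \<open>n\<close>, the
  weights sum to at most 1, and the remaining 1 is below \<open>(2 + sqrt 2) ^ n\<close>.\<close>

lemma card_profiles_bound: "real (card (profiles n)) \<le> (real n + 1) * (2 + sqrt 2) ^ n"
proof (induction n rule: less_induct)
  case (less n)
  let ?\<beta> = "2 + sqrt 2 :: real"
  have pos: "0 < ?\<beta>" by (simp add: add_pos_nonneg)
  have one: "1 \<le> ?\<beta> ^ n" by (intro one_le_power) (simp add: add_increasing2)
  have "real (card (profiles n)) \<le> real (1 + (\<Sum>m=1..n. (m + 1) * card (profiles (n - m))))"
    using card_profiles_le by (simp only: of_nat_le_iff)
  also have "\<dots> = 1 + (\<Sum>m=1..n. (real m + 1) * real (card (profiles (n - m))))"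
    by (simp add: algebra_simps)
  also have "(\<Sum>m=1..n. (real m + 1) * real (card (profiles (n - m))))
      \<le> (\<Sum>m=1..n. (real n * ?\<beta> ^ n) * ((real m + 1) / ?\<beta> ^ m))"
  proof (rule sum_mono)
    fix m assume m: "m \<in> {1..n}"
    then have "real (card (profiles (n - m))) \<le> (real (n - m) + 1) * ?\<beta> ^ (n - m)"
      by (intro less.IH) auto
    also have "\<dots> \<le> real n * ?\<beta> ^ (n - m)"
      using m pos by (intro mult_right_mono) auto
    also have "\<dots> = real n * (?\<beta> ^ n / ?\<beta> ^ m)"
      using m pos by (simp add: power_diff)
    finally have "(real m + 1) * real (card (profiles (n - m)))
        \<le> (real m + 1) * (real n * (?\<beta> ^ n / ?\<beta> ^ m))"
      by (intro mult_left_mono) auto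
    then show "(real m + 1) * real (card (profiles (n - m)))
        \<le> (real n * ?\<beta> ^ n) * ((real m + 1) / ?\<beta> ^ m)"
      by (simp add: mult_ac)
  qed
  also have "\<dots> = (real n * ?\<beta> ^ n) * (\<Sum>m=1..n. (real m + 1) / ?\<beta> ^ m)"
    by (simp only: sum_distrib_left)
  also have "\<dots> \<le> (real n * ?\<beta> ^ n) * 1"
    using pos by (intro mult_left_mono sum_Suc_div_power_le_one) auto
  finally have "real (card (profiles n)) \<le> 1 + real n * ?\<beta> ^ n" by simp
  then show ?case using one by (simp only: distrib_right mult_1)
qed

section \<open>Shifts along the relaxed optimality equations\<close>

locale game =
  fixes G :: dgame
  assumes discounted_game: "discounted_game G"
begin

abbreviation n where "n \<equiv> num_nodes G"
abbreviation l where "l \<equiv> discount G"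

text \<open>Multiplying by the sign turns Min's inequalities, gains and losses into those of Max, so
  that later arguments handle both players at once.\<close>

definition sg :: "nat \<Rightarrow> real" where
  "sg a = (if a \<in> max_nodes G then 1 else - 1)"

definition slack :: "(nat \<Rightarrow> real) \<Rightarrow> nat \<Rightarrow> nat \<Rightarrow> real" where
  "slack x a b = sg a * (x a - (weight G (a, b) + l * x b))"

definition feasible :: "(nat \<Rightarrow> real) \<Rightarrow> bool" where
  "feasible x \<longleftrightarrow> (\<forall>a b. (a, b) \<in> edges G \<longrightarrow> 0 \<le> slack x a b)"

definition tight :: "(nat \<Rightarrow> real) \<Rightarrow> nat \<Rightarrow> nat \<Rightarrow> bool" where
  "tight x a b \<longleftrightarrow> (a, b) \<in> edges G \<and> slack x a b = 0"

text \<open>One round of value iteration for the game on the tight edges in which a player who cannot move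
  pays 1. Since all values lie in \<open>{-1..1}\<close>, the option \<open>-1\<close> is the best one exactly
  at a node without tight edges.\<close>

definition backup :: "(nat \<Rightarrow> real) \<Rightarrow> (nat \<Rightarrow> real) \<Rightarrow> nat \<Rightarrow> real" where
  "backup x v a = (if a < n
     then sg a * Max (insert (- 1) ((\<lambda>b. sg a * (l * v b)) ` {b. tight x a b})) else 0)"

definition backups :: "(nat \<Rightarrow> real) \<Rightarrow> nat \<Rightarrow> nat \<Rightarrow> real" where
  "backups x t = (backup x ^^ t) (\<lambda>_. 0)"

definition shift :: "(nat \<Rightarrow> real) \<Rightarrow> nat \<Rightarrow> real" where
  "shift x = backups x n"

text \<open>The reciprocal of the largest feasible step along the shift. Tight edges contribute \<open>0\<close>,
  because \<open>y / 0 = 0\<close>.\<close>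

definition speed :: "(nat \<Rightarrow> real) \<Rightarrow> real" where
  "speed x = Max (insert 0
     ((\<lambda>(a, b). sg a * (l * shift x b - shift x a) / slack x a b) ` edges G))"

definition move :: "(nat \<Rightarrow> real) \<Rightarrow> nat \<Rightarrow> real" where
  "move x a = x a + shift x a / speed x"

definition profile :: "(nat \<Rightarrow> real) \<Rightarrow> nat \<Rightarrow> nat \<times> nat" where
  "profile x k = (card {a. a < n \<and> sg a * shift x a = l ^ k},
     card {a. a < n \<and> sg a * shift x a = - (l ^ k)})"

lemma l_pos: "0 < l" and l_less_1: "l < 1"
  using discounted_game by (auto simp: discounted_game_def)

lemma edge_less: "(a, b) \<in> edges G \<Longrightarrow> a < n \<and> b < n"
  using discounted_game by (auto simp: discounted_game_def nodes_def)

lemma ex_edge: "a < n \<Longrightarrow> \<exists>b. (a, b) \<in> edges G"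
  using discounted_game by (auto simp: discounted_game_def nodes_def)

lemma finite_edges: "finite (edges G)"
  by (rule finite_subset[of _ "{..<n} \<times> {..<n}"]) (auto dest: edge_less)

lemma finite_tight: "finite {b. tight x a b}"
  by (rule finite_subset[of _ "{..<n}"]) (auto simp: tight_def dest: edge_less)

lemma sg_sg [simp]: "sg a * sg a = 1" "sg a * (sg a * y) = y" "\<bar>sg a\<bar> = 1"
  by (auto simp: sg_def)

lemma sg_cases: obtains "sg a = 1" | "sg a = - 1"
  unfolding sg_def by metis

lemma sg_ne_0 [simp]: "sg a \<noteq> 0"
  by (simp add: sg_def)

lemma abs_sg_mult [simp]: "\<bar>sg a * y\<bar> = \<bar>y\<bar>"
  by (simp add: abs_mult)

lemma abs_eq_sg_iff: "0 \<le> y \<Longrightarrow> \<bar>v\<bar> = y \<longleftrightarrow> sg a * v = y \<or> sg a * v = - y"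
  by (cases rule: sg_cases[of a]) auto

lemma sg_eq_iff: "sg a * y = z \<longleftrightarrow> y = sg a * z"
  by (auto simp: sg_def)

section \<open>Value iteration for the auxiliary game is exact after \<open>n\<close> rounds\<close>

definition trunc :: "nat \<Rightarrow> real \<Rightarrow> real" where
  "trunc t v = (if l ^ t < \<bar>v\<bar> then v else 0)"

lemma mono_trunc: "mono (trunc t)"
proof (rule monoI)
  fix u v :: real assume uv: "u \<le> v"
  have "0 < l ^ t" using l_pos by simp
  then show "trunc t u \<le> trunc t v"
    using uv by (auto simp: trunc_def abs_if split: if_splits)
qed

lemma trunc_sg: "trunc t (sg a * v) = sg a * trunc t v"
  by (simp add: trunc_def)

lemma trunc_Suc: "trunc (Suc t) (l * v) = l * trunc t v"
  using l_pos by (simp add: trunc_def abs_mult)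

lemma trunc_Suc_minus_1: "trunc (Suc t) (- 1) = - 1"
proof -
  have "l ^ Suc t < 1" using l_pos l_less_1 by (intro power_Suc_less_one)
  then show ?thesis by (simp add: trunc_def)
qed

text \<open>\<open>trunc t\<close> erases the levels from \<open>t\<close> on. It is monotone, so it
  passes through \<open>Max\<close>; it commutes with the sign; the factor \<open>l\<close> moves
  every level by one, hence \<open>Suc t\<close>; and the option -1, on level 0, survives.\<close>

lemma backup_trunc: "backup x (\<lambda>b. trunc t (v b)) a = trunc (Suc t) (backup x v a)"
proof (cases "a < n")
  case True
  let ?S = "(\<lambda>b. sg a * (l * v b)) ` {b. tight x a b}"
  have "trunc (Suc t) (backup x v a) = sg a * trunc (Suc t) (Max (insert (- 1) ?S))"
    using True by (simp add: backup_def trunc_sg)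
  also have "trunc (Suc t) (Max (insert (- 1) ?S)) = Max (trunc (Suc t) ` insert (- 1) ?S)"
    by (intro mono_Max_commute mono_trunc) (auto simp: finite_tight)
  also have "trunc (Suc t) ` insert (- 1) ?S
      = insert (- 1) ((\<lambda>b. sg a * (l * trunc t (v b))) ` {b. tight x a b})"
    by (simp add: image_image trunc_sg trunc_Suc trunc_Suc_minus_1)
  finally show ?thesis using True by (simp add: backup_def)
qed (simp add: backup_def trunc_def)

lemma backups_0 [simp]: "backups x 0 = (\<lambda>_. 0)"
  by (simp add: backups_def)

lemma backups_Suc: "backups x (Suc t) = backup x (backups x t)"
  by (simp add: backups_def)

lemma backup_cases:
  assumes "a < n"
  obtains "sg a * backup x v a = - 1" | b where "tight x a b" "backup x v a = l * v b"
proof -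
  have "Max (insert (- 1) ((\<lambda>b. sg a * (l * v b)) ` {b. tight x a b}))
      \<in> insert (- 1) ((\<lambda>b. sg a * (l * v b)) ` {b. tight x a b})"
    by (rule Max_in) (auto simp: finite_tight)
  then have "sg a * backup x v a \<in> insert (- 1) ((\<lambda>b. sg a * (l * v b)) ` {b. tight x a b})"
    using assms by (simp add: backup_def)
  then show ?thesis using that by (auto simp: sg_eq_iff)
qed

lemma backup_ge:
  assumes "tight x a b"
  shows "sg a * (l * v b) \<le> sg a * backup x v a"
proof -
  have "a < n" using assms by (auto simp: tight_def dest: edge_less)
  moreover have "sg a * (l * v b) \<le> Max (insert (- 1) ((\<lambda>b. sg a * (l * v b)) ` {b. tight x a b}))"
    by (rule Max_ge) (use assms in \<open>auto simp: finite_tight\<close>)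
  ultimately show ?thesis by (simp add: backup_def)
qed

lemma backups_levels: "backups x t a = 0 \<or> (\<exists>k. \<bar>backups x t a\<bar> = l ^ k)"
proof (induction t arbitrary: a)
  case (Suc t)
  show ?case
  proof (cases "a < n")
    case True
    then show ?thesis
    proof (cases rule: backup_cases[where x = x and v = "backups x t"])
      case 1
      then have "\<bar>sg a * backups x (Suc t) a\<bar> = \<bar>- 1\<bar>" by (simp only: backups_Suc)
      then have "\<bar>backups x (Suc t) a\<bar> = l ^ 0" by simp
      then show ?thesis by blast
    next
      case (2 b)
      then have "backups x (Suc t) a = l * backups x t b" by (simp add: backups_Suc)
      moreover have "\<bar>l * backups x t b\<bar> = l ^ Suc k" if "\<bar>backups x t b\<bar> = l ^ k" for k
        using that l_pos by (simp add: abs_mult)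
      ultimately show ?thesis using Suc.IH[of b] by (metis mult_zero_right)
    qed
  qed (simp add: backups_Suc backup_def)
qed simp

lemma backups_abs_le_1: "\<bar>backups x t a\<bar> \<le> 1"
  using backups_levels[of x t a] l_pos l_less_1 power_le_one[of l] by (metis abs_zero less_imp_le zero_le_one)

text \<open>Round \<open>t + 1\<close> only adds nodes of level \<open>t\<close>. The induction
  starts because no value exceeds \<open>l ^ 0\<close>, and \<open>backup_trunc\<close> carries it
  on.\<close>

lemma backups_trunc: "backups x t a = trunc t (backups x (Suc t) a)"
proof (induction t arbitrary: a)
  case 0
  show ?case using backups_abs_le_1[of x 1 a] by (simp add: trunc_def)
next
  case (Suc t)
  have "backups x t = (\<lambda>b. trunc t (backups x (Suc t) b))" using Suc by blast
  then have "backups x (Suc t) a = backup x (\<lambda>b. trunc t (backups x (Suc t) b)) a"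
    by (simp only: backups_Suc[of x t])
  then show ?case by (simp only: backup_trunc backups_Suc[of x "Suc t"])
qed

text \<open>By \<open>backups_trunc\<close> a nonzero value never changes again, so every round
  before stabilisation adds a node to the nonzero set \<open>Z\<close>. As there are only
  \<open>n\<close> nodes, round \<open>n\<close> is already stationary.\<close>

lemma backup_shift: "backup x (shift x) = shift x"
proof (rule ccontr)
  assume neq: "backup x (shift x) \<noteq> shift x"
  define Z where "Z t = {a. backups x t a \<noteq> 0}" for t
  have Z_sub: "Z t \<subseteq> {..<n}" for t
    by (cases t) (auto simp: Z_def backups_Suc backup_def)
  have stab: "backups x (t + m) = backups x t" if "backups x (Suc t) = backups x t" for t m
    using that by (induction m) (simp_all add: backups_Suc)
  have ne: "backups x (Suc t) \<noteq> backups x t" if "t \<le> n" for t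
  proof
    assume eq: "backups x (Suc t) = backups x t"
    then have "backups x n = backups x t" "backups x (Suc n) = backups x t"
      using stab[OF eq, of "n - t"] stab[OF eq, of "Suc n - t"] that by (simp_all add: Suc_diff_le)
    then show False using neq by (simp add: shift_def backups_Suc)
  qed
  have "card (Z t) \<ge> t" if "t \<le> Suc n" for t
    using that
  proof (induction t)
    case (Suc t)
    have "Z t \<subset> Z (Suc t)"
    proof
      have keep: "backups x t a = backups x (Suc t) a" if "backups x t a \<noteq> 0" for a
        using backups_trunc[of x t a] that by (simp add: trunc_def split: if_splits)
      then show "Z t \<subseteq> Z (Suc t)" unfolding Z_def by auto
      show "Z t \<noteq> Z (Suc t)"
      proof
        assume "Z t = Z (Suc t)"
        then have "backups x (Suc t) a = backups x t a" for a
          using keep[of a] unfolding Z_def by (metis (mono_tags, lifting) mem_Collect_eq)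
        then show False using ne[of t] Suc.prems by auto
      qed
    qed
    then have "card (Z t) < card (Z (Suc t))"
      by (rule psubset_card_mono[rotated]) (rule finite_subset[OF Z_sub], simp)
    then show ?case using Suc by simp
  qed simp
  then have "Suc n \<le> card (Z (Suc n))" by simp
  also have "\<dots> \<le> card {..<n}" by (intro card_mono Z_sub) simp
  finally show False by simp
qed

lemma shift_levels: "shift x a = 0 \<or> (\<exists>k. \<bar>shift x a\<bar> = l ^ k)"
  unfolding shift_def by (rule backups_levels)

lemma shift_abs_le_1: "\<bar>shift x a\<bar> \<le> 1"
  unfolding shift_def by (rule backups_abs_le_1)

lemma shift_outside: "\<not> a < n \<Longrightarrow> shift x a = 0"
  using backup_shift[of x] by (metis backup_def)

lemma l_shift_abs_less_1: "\<bar>l * shift x b\<bar> < 1"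
proof -
  have "\<bar>l * shift x b\<bar> \<le> l * 1"
    using l_pos shift_abs_le_1[of x b] by (simp add: abs_mult)
  then show ?thesis using l_less_1 by simp
qed

lemma l_shift_greater: "- 1 < sg a * (l * shift x b)"
  using l_shift_abs_less_1[of x b] abs_sg_mult[of a "l * shift x b"] by linarith

lemma shift_ge: "tight x a b \<Longrightarrow> sg a * (l * shift x b) \<le> sg a * shift x a"
  using backup_ge[of x a b "shift x"] by (simp add: backup_shift)

lemma shift_cases:
  assumes "a < n"
  obtains "\<And>b. \<not> tight x a b" "sg a * shift x a = - 1"
  | b where "tight x a b" "shift x a = l * shift x b"
  using assms
proof (cases rule: backup_cases[where x = x and v = "shift x"])
  case 1
  then have "sg a * shift x a = - 1" by (simp add: backup_shift)
  moreover from this have "\<not> tight x a b" for b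
    using shift_ge[of x a b] l_shift_greater[of a x b] by linarith
  ultimately show ?thesis using that(1) by blast
next
  case (2 b)
  then show ?thesis using that(2) by (simp add: backup_shift)
qed

section \<open>Moving along the shift: feasibility, blocking edges, stopping\<close>

lemma speed_nonneg: "0 \<le> speed x"
  unfolding speed_def by (rule Max_ge) (auto simp: finite_edges)

lemma speed_ge:
  assumes "(a, b) \<in> edges G"
  shows "sg a * (l * shift x b - shift x a) / slack x a b \<le> speed x"
  unfolding speed_def by (rule Max_ge) (use assms finite_edges in \<open>auto simp: image_iff\<close>)

lemma speed_cases:
  obtains "speed x = 0"
  | a b where "(a, b) \<in> edges G" "speed x = sg a * (l * shift x b - shift x a) / slack x a b"
proof -
  have "speed x \<in> insert 0
     ((\<lambda>(a, b). sg a * (l * shift x b - shift x a) / slack x a b) ` edges G)"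
    unfolding speed_def by (rule Max_in) (auto simp: finite_edges)
  then show ?thesis using that by auto
qed

lemma slack_move:
  "slack (move x) a b = slack x a b - sg a * (l * shift x b - shift x a) / speed x"
  by (simp add: slack_def move_def algebra_simps add_divide_distrib diff_divide_distrib)

text \<open>The slack of an edge shrinks at the rate
  \<open>sg a * (l * shift x b - shift x a)\<close>. By \<open>shift_ge\<close> this rate is not
  positive on tight edges; on any other edge the step \<open>1 / speed x\<close> ends no later than
  its slack does.\<close>

lemma feasible_move:
  assumes "feasible x"
  shows "feasible (move x)"
  unfolding feasible_def
proof (intro allI impI)
  fix a b assume ab: "(a, b) \<in> edges G"
  let ?r = "sg a * (l * shift x b - shift x a)"
  have s: "0 \<le> slack x a b" using assms ab by (simp add: feasible_def)
  have "?r / speed x \<le> slack x a b"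
  proof (cases "?r \<le> 0")
    case True
    then have "?r / speed x \<le> 0" using speed_nonneg by (simp add: divide_nonpos_nonneg)
    then show ?thesis using s by linarith
  next
    case False
    then have "\<not> tight x a b" using shift_ge[of x a b] by (auto simp: right_diff_distrib)
    then have s': "0 < slack x a b" using s ab by (auto simp: tight_def)
    then have "0 < ?r / slack x a b" using False by simp
    then have "0 < speed x" using speed_ge[OF ab, of x] by linarith
    then show ?thesis using speed_ge[OF ab, of x] s' by (simp add: field_simps)
  qed
  then show "0 \<le> slack (move x) a b" by (simp add: slack_move)
qed

text \<open>The slack has rate 0 on an edge that realises the shift. This is what makes the old and
  the new shift comparable.\<close>

lemma tight_move:
  assumes "tight x a b" "shift x a = l * shift x b"
  shows "tight (move x) a b"
  using assms by (simp add: tight_def slack_move)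

text \<open>An edge attaining the maximum in \<open>speed\<close> blocks the move and becomes tight.
  It offers its node strictly more than the old shift, which therefore does not solve the new
  auxiliary game.\<close>

lemma new_tight_edge:
  assumes "0 < speed x" "feasible x"
  obtains a b where "tight (move x) a b" "sg a * shift x a < sg a * (l * shift x b)"
proof (cases rule: speed_cases[of x])
  case (2 a b)
  let ?r = "sg a * (l * shift x b - shift x a)"
  have "0 \<le> slack x a b" using 2 assms by (simp add: feasible_def)
  \<comment> \<open>With slack 0 the quotient, and so the speed, would be 0.\<close>
  moreover have "slack x a b \<noteq> 0" using 2 assms(1) by auto
  ultimately have s: "0 < slack x a b" by simp
  then have r: "0 < ?r" using 2(2) assms(1) by (simp add: zero_less_divide_iff)
  have "speed x * slack x a b = ?r" using 2(2) s by simp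
  then have "?r / speed x = slack x a b" using assms(1) by (simp add: field_simps)
  then have "tight (move x) a b" using 2(1) by (simp add: tight_def slack_move)
  moreover have "sg a * shift x a < sg a * (l * shift x b)" using r by (simp add: right_diff_distrib)
  ultimately show ?thesis using that by blast
qed (use assms in simp)

lemma shift_move_ne:
  assumes "0 < speed x" "feasible x"
  shows "shift (move x) \<noteq> shift x"
proof
  assume eq: "shift (move x) = shift x"
  obtain a b where "tight (move x) a b" "sg a * shift x a < sg a * (l * shift x b)"
    using new_tight_edge[OF assms] .
  then show False using shift_ge[of "move x" a b] eq by simp
qed

text \<open>At a node without tight edges the owner loses 1, while a successor contributes more than
  -1 after discounting. So the positive slack of any outgoing edge shrinks and forces a positive
  speed.\<close>

lemma speed_0_tight:
  assumes "speed x = 0" "feasible x" "a < n"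
  shows "\<exists>b. tight x a b"
proof (rule ccontr)
  assume no: "\<not> (\<exists>b. tight x a b)"
  then have "sg a * shift x a = - 1" using shift_cases[OF assms(3), of x] by blast
  obtain b where ab: "(a, b) \<in> edges G" using ex_edge[OF assms(3)] by blast
  have "0 < slack x a b" using no ab assms(2) by (auto simp: tight_def feasible_def less_le)
  moreover have "0 < sg a * (l * shift x b - shift x a)"
    using \<open>sg a * shift x a = - 1\<close> l_shift_greater[of a x b] by (simp add: right_diff_distrib)
  ultimately have "0 < sg a * (l * shift x b - shift x a) / slack x a b" by simp
  then show False using speed_ge[OF ab, of x] assms(1) by simp
qed

lemma value_vector_eqI:
  assumes feas: "feasible x" and tight: "\<And>a. a < n \<Longrightarrow> \<exists>b. tight x a b" and "a < n"
  shows "value_vector G a = x a"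
proof -
  \<comment> \<open>\<open>value_vector\<close> is unique only among vectors that vanish outside of
    the nodes, and nothing is assumed about \<open>x\<close> there.\<close>
  define y where "y a = (if a < n then x a else 0)" for a
  have fin: "finite (options G y a)" for a
    unfolding options_def
    by (rule finite_imageI, rule finite_subset[of _ "{..<n}"]) (auto dest: edge_less)
  have opt: "options G y a = (\<lambda>b. weight G (a, b) + l * x b) ` {b. (a, b) \<in> edges G}" for a
    unfolding options_def by (rule image_cong) (auto simp: y_def dest: edge_less)
  have mx: "a < n" if "a \<in> max_nodes G" for a
    using that discounted_game by (auto simp: discounted_game_def nodes_def)
  have "y a = Max (options G y a)" if a: "a \<in> max_nodes G" for a
  proof (rule Max_eqI[symmetric, OF fin])
    obtain b where "tight x a b" using tight[OF mx[OF a]] by blast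
    then show "y a \<in> options G y a"
      using mx[OF a] a unfolding opt by (auto simp: tight_def slack_def sg_def y_def)
    show "z \<le> y a" if "z \<in> options G y a" for z
      using that mx[OF a] a feas unfolding opt by (fastforce simp: feasible_def slack_def sg_def y_def)
  qed
  moreover have "y a = Min (options G y a)" if a: "a \<in> min_nodes G" for a
  proof (rule Min_eqI[symmetric, OF fin])
    have an: "a < n" "a \<notin> max_nodes G" using a by (auto simp: min_nodes_def nodes_def)
    obtain b where "tight x a b" using tight[OF an(1)] by blast
    then show "y a \<in> options G y a"
      using an unfolding opt by (force simp: tight_def slack_def sg_def y_def)
    show "y a \<le> z" if "z \<in> options G y a" for z
      using that an feas unfolding opt by (fastforce simp: feasible_def slack_def sg_def y_def)
  qed
  ultimately have "optimality_equations G y" by (simp add: optimality_equations_def)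
  moreover have "\<forall>a. a \<notin> nodes G \<longrightarrow> y a = 0" by (simp add: y_def nodes_def)
  ultimately have "value_vector G = y"
    unfolding value_vector_def
    by (intro the1_equality[OF value_vector_ex1[OF discounted_game]]) blast
  then show ?thesis using assms(3) by (simp add: y_def)
qed

section \<open>Progress: the profile climbs with every move\<close>

lemma l_power_eq_iff: "l ^ i = l ^ j \<longleftrightarrow> i = j"
proof -
  have "l ^ j < l ^ i" if "i < j" for i j using that l_pos l_less_1 by (rule power_strict_decreasing)
  then show ?thesis by (metis less_irrefl linorder_neqE_nat)
qed

text \<open>No level is skipped: a node on level \<open>Suc k\<close> gets its value along a tight
  edge from a node on level \<open>k\<close>, since nodes without tight edges are on level 0. The
  sums are bounded because levels are disjoint sets of nodes.\<close>

lemma profile_in_profiles: "profile x \<in> profiles n"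
proof -
  define H where "H k = {a. a < n \<and> \<bar>shift x a\<bar> = l ^ k}" for k
  have H: "fst (profile x k) + snd (profile x k) = card (H k)" for k
  proof -
    have pos: "0 < l ^ k" using l_pos by simp
    have "H k = {a. a < n \<and> sg a * shift x a = l ^ k} \<union> {a. a < n \<and> sg a * shift x a = - (l ^ k)}"
      unfolding H_def using abs_eq_sg_iff[OF less_imp_le[OF pos]] by blast
    moreover have "{a. a < n \<and> sg a * shift x a = l ^ k} \<inter> {a. a < n \<and> sg a * shift x a = - (l ^ k)} = {}"
      using pos by auto
    ultimately have "card (H k) = card {a. a < n \<and> sg a * shift x a = l ^ k}
        + card {a. a < n \<and> sg a * shift x a = - (l ^ k)}"
      by (simp add: card_Un_disjoint)
    then show ?thesis by (simp add: profile_def)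
  qed
  have finH: "finite (H k)" for k by (simp add: H_def)
  have "profile x (Suc k) = (0, 0)" if "profile x k = (0, 0)" for k
  proof -
    have empty: "H k = {}" using H[of k] that finH by simp
    have "a \<notin> H (Suc k)" for a
    proof
      assume "a \<in> H (Suc k)"
      then have a: "a < n" "\<bar>shift x a\<bar> = l ^ Suc k" by (auto simp: H_def)
      from a(1) show False
      proof (cases rule: shift_cases[where x = x])
        case 1
        then have "\<bar>shift x a\<bar> = 1" using abs_sg_mult[of a "shift x a"] by simp
        then show False using a(2) l_power_eq_iff[of "Suc k" 0] by simp
      next
        case (2 b)
        then have "\<bar>shift x b\<bar> = l ^ k" using a(2) l_pos by (simp add: abs_mult)
        moreover have "b < n" using 2(1) by (auto simp: tight_def dest: edge_less)
        ultimately show False using empty by (auto simp: H_def)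
      qed
    qed
    then have "H (Suc k) = {}" by blast
    then show ?thesis using H[of "Suc k"] by (simp add: prod_eq_iff)
  qed
  moreover have "(\<Sum>k<m. fst (profile x k) + snd (profile x k)) \<le> n" for m
  proof -
    have "(\<Sum>k<m. fst (profile x k) + snd (profile x k)) = (\<Sum>k<m. card (H k))" by (simp only: H)
    also have "\<dots> = card (\<Union>k<m. H k)"
      by (rule card_UN_disjoint[symmetric]) (auto simp: H_def l_power_eq_iff)
    also have "\<dots> \<le> card {..<n}" by (intro card_mono) (auto simp: H_def)
    finally show ?thesis by simp
  qed
  ultimately show ?thesis by (simp add: profiles_def)
qed

text \<open>Let \<open>k\<close> be the first level on which the two shifts disagree. The tight edges that realise the
  old shift stay tight. So a node that gains \<open>l ^ k\<close> from its owner's point of view keeps doing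
  so, while a node that now loses \<open>l ^ k\<close> must have lost it before, since the edge that was best
  for it is still available and leads to one of the higher levels, which have not changed.\<close>

lemma profile_move_less:
  assumes "0 < speed x" "feasible x"
  shows "profile_less (profile x) (profile (move x))"
proof -
  let ?d = "shift x" and ?e = "shift (move x)"
  define same where "same k \<longleftrightarrow> (\<forall>a. \<bar>?d a\<bar> = l ^ k \<or> \<bar>?e a\<bar> = l ^ k \<longrightarrow> ?d a = ?e a)" for k
  have "\<exists>k. \<not> same k"
  proof (rule ccontr)
    assume "\<not> (\<exists>k. \<not> same k)"
    then have "same k" for k by blast
    then have "?d a = ?e a" for a
      using shift_levels[of x a] shift_levels[of "move x" a] unfolding same_def by metis
    then show False using shift_move_ne[OF assms] by auto
  qed
  define k where "k = (LEAST k. \<not> same k)"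
  have k: "\<not> same k" unfolding k_def using \<open>\<exists>k. \<not> same k\<close> by (rule LeastI_ex)
  have below: "same j" if "j < k" for j using that not_less_Least unfolding k_def by blast
  \<comment> \<open>Shift values are 0 or signed powers of \<open>l\<close>, so an absolute value
    above \<open>l ^ k\<close> belongs to a level before \<open>k\<close>, where \<open>same\<close>
    holds.\<close>
  have agree: "?d a = ?e a" if "l ^ k < \<bar>?d a\<bar> \<or> l ^ k < \<bar>?e a\<bar>" for a
  proof -
    have *: "\<exists>j<k. \<bar>v\<bar> = l ^ j" if v: "l ^ k < \<bar>v\<bar>" "v = 0 \<or> (\<exists>j. \<bar>v\<bar> = l ^ j)" for v
    proof -
      have "v \<noteq> 0" using v(1) zero_less_power[OF l_pos, of k] by auto
      then obtain j where j: "\<bar>v\<bar> = l ^ j" using v(2) by blast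
      have "\<not> k \<le> j" using power_decreasing[of k j l] l_pos l_less_1 j v(1) by force
      then show ?thesis using j by (metis not_le)
    qed
    show ?thesis
      using that *[OF _ shift_levels] below unfolding same_def by blast
  qed
  have grow: "sg a * ?e a = l ^ k" if a: "a < n" "sg a * ?d a = l ^ k" for a
    using a(1)
  proof (cases rule: shift_cases[where x = x])
    case 1
    have "0 < l ^ k" using l_pos by simp
    then show ?thesis using 1 a(2) by simp
  next
    case (2 b)
    have d: "l * (sg a * ?d b) = l ^ k" using 2(2) a(2) by (simp add: mult.left_commute)
    have "l ^ k < \<bar>?d b\<bar>"
    proof -
      have "0 < sg a * ?d b" using d l_pos by (metis zero_less_mult_pos zero_less_power)
      then have "l * (sg a * ?d b) < sg a * ?d b"
        using mult_strict_right_mono[OF l_less_1, of "sg a * ?d b"] by (simp only: mult_1)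
      then show ?thesis using d abs_sg_mult[of a "?d b"] \<open>0 < sg a * ?d b\<close> by linarith
    qed
    then have "?e b = ?d b" using agree by metis
    moreover have "tight (move x) a b" using tight_move 2 .
    ultimately have ge: "l ^ k \<le> sg a * ?e a"
      using shift_ge[of "move x" a b] d by (simp add: mult.left_commute)
    have "\<not> l ^ k < sg a * ?e a"
    proof
      assume less: "l ^ k < sg a * ?e a"
      then have "l ^ k < \<bar>?e a\<bar>" using abs_sg_mult[of a "?e a"] by linarith
      then have "?d a = ?e a" using agree by blast
      then show False using less a(2) by simp
    qed
    then show ?thesis using ge by simp
  qed
  have shrink: "sg a * ?d a = - (l ^ k)" if a: "a < n" "sg a * ?e a = - (l ^ k)" for a
  proof -
    have le: "sg a * ?d a \<le> - (l ^ k)"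
      using a(1)
    proof (cases rule: shift_cases[where x = x])
      case 1
      have "l ^ k \<le> 1" using l_pos l_less_1 by (simp add: power_le_one)
      then show ?thesis using 1 by simp
    next
      case (2 b)
      have "tight (move x) a b" using tight_move 2 .
      then have e: "l * (sg a * ?e b) \<le> - (l ^ k)"
        using shift_ge[of "move x" a b] a(2) by (simp add: mult.left_commute)
      have "0 < l ^ k" using l_pos by simp
      then have neg: "sg a * ?e b < 0" using e l_pos by (smt (verit) mult_nonneg_nonneg)
      then have "sg a * ?e b < l * (sg a * ?e b)"
        using mult_strict_right_mono_neg[OF l_less_1, of "sg a * ?e b"] by (simp only: mult_1)
      then have "l ^ k < \<bar>?e b\<bar>" using e abs_sg_mult[of a "?e b"] neg by linarith
      then have "?e b = ?d b" using agree by metis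
      then show ?thesis using 2(2) e by (simp add: mult.left_commute)
    qed
    have "\<not> sg a * ?d a < - (l ^ k)"
    proof
      assume less: "sg a * ?d a < - (l ^ k)"
      then have "l ^ k < \<bar>?d a\<bar>" using abs_sg_mult[of a "?d a"] by linarith
      then have "?d a = ?e a" using agree by blast
      then show False using less a(2) by simp
    qed
    then show ?thesis using le by simp
  qed
  let ?A = "\<lambda>j. {a. a < n \<and> sg a * ?d a = l ^ j}" and ?A' = "\<lambda>j. {a. a < n \<and> sg a * ?e a = l ^ j}"
  let ?B = "\<lambda>j. {a. a < n \<and> sg a * ?d a = - (l ^ j)}"
  let ?B' = "\<lambda>j. {a. a < n \<and> sg a * ?e a = - (l ^ j)}"
  have abs_lev: "\<bar>v\<bar> = l ^ j" if "sg a * v = l ^ j \<or> sg a * v = - (l ^ j)" for a v j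
    using that abs_eq_sg_iff[of "l ^ j" v a] l_pos by simp
  have A: "?A k \<subseteq> ?A' k" using grow by blast
  have B: "?B' k \<subseteq> ?B k" using shrink by blast
  have "profile x j = profile (move x) j" if "j < k" for j
  proof -
    have "sg a * ?d a = y \<longleftrightarrow> sg a * ?e a = y" if "y = l ^ j \<or> y = - (l ^ j)" for a y
      using that below[OF \<open>j < k\<close>] abs_lev unfolding same_def by metis
    then have "?A j = ?A' j" "?B j = ?B' j" by simp_all
    then show ?thesis by (simp add: profile_def)
  qed
  moreover have "profile x k \<noteq> profile (move x) k"
  proof
    assume "profile x k = profile (move x) k"
    then have "card (?A k) = card (?A' k)" "card (?B' k) = card (?B k)" by (simp_all add: profile_def)
    \<comment> \<open>Inclusions between finite sets of equal size are equalities. Then the shifts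
      agree on all of level \<open>k\<close>, against its choice.\<close>
    then have "?A k = ?A' k" "?B' k = ?B k"
      using card_subset_eq[OF _ A] card_subset_eq[OF _ B] by simp_all
    then have *: "sg a * ?d a = l ^ k \<longleftrightarrow> sg a * ?e a = l ^ k"
      "sg a * ?d a = - (l ^ k) \<longleftrightarrow> sg a * ?e a = - (l ^ k)" if "a < n" for a
      using that by blast+
    have "?d a = ?e a" if "\<bar>?d a\<bar> = l ^ k \<or> \<bar>?e a\<bar> = l ^ k" for a
    proof (cases "a < n")
      case True
      have iff: "\<bar>v\<bar> = l ^ k \<longleftrightarrow> sg a * v = l ^ k \<or> sg a * v = - (l ^ k)" for v
        by (rule abs_eq_sg_iff) (use l_pos in simp)
      have "sg a * ?d a = sg a * ?e a"
        using that *[OF True] iff by metis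
      then show ?thesis by simp
    qed (simp add: shift_outside)
    then show False using k by (simp add: same_def)
  qed
  moreover have "fst (profile x k) \<le> fst (profile (move x) k)"
    "snd (profile (move x) k) \<le> snd (profile x k)"
    using A B by (auto simp: profile_def intro!: card_mono)
  ultimately show ?thesis by (auto simp: profile_less_def)
qed

definition rank :: "(nat \<Rightarrow> real) \<Rightarrow> nat" where
  "rank x = card {p \<in> profiles n. profile_less (profile x) p}"

lemma rank_le: "rank x \<le> card (profiles n)"
  unfolding rank_def by (intro card_mono finite_profiles) auto

text \<open>By transitivity the set of larger profiles can only shrink, and
  \<open>profile (move x)\<close> itself drops out of it.\<close>

lemma rank_move:
  assumes "0 < speed x" "feasible x"
  shows "rank (move x) < rank x"
  unfolding rank_def
proof (rule psubset_card_mono)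
  show "{p \<in> profiles n. profile_less (profile (move x)) p} \<subset> {p \<in> profiles n. profile_less (profile x) p}"
    using profile_move_less[OF assms] profile_less_trans profile_less_irrefl profile_in_profiles by blast
qed (simp add: finite_profiles)

text \<open>An upper bound of all \<open>\<bar>w\<bar>\<close>; the squares avoid a case distinction
  on the sign. A missing edge counts 1 because its memory cell holds 0, so the program can sum over
  all pairs alike.\<close>

definition bound :: real where
  "bound = (\<Sum>a<n. \<Sum>b<n. if (a, b) \<in> edges G then weight G (a, b) * weight G (a, b) + 1 else 1)"

text \<open>Nodes of Max start at \<open>M\<close>, nodes of Min at \<open>- M\<close>. Whoever owns
  the successor, the slack is at least \<open>M - l * M - \<bar>w\<bar>\<close>, and
  \<open>M\<close> is chosen so that \<open>M - l * M\<close> is \<open>bound\<close>.\<close>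

lemma feasible_start: "feasible (\<lambda>a. sg a * (bound / (1 - l)))"
  unfolding feasible_def
proof (intro allI impI)
  fix a b assume ab: "(a, b) \<in> edges G"
  let ?f = "\<lambda>a b. if (a, b) \<in> edges G then weight G (a, b) * weight G (a, b) + 1 else 1"
  have f: "0 \<le> ?f a b" for a b by simp
  define M where "M = bound / (1 - l)"
  have "\<bar>weight G (a, b)\<bar> \<le> weight G (a, b) * weight G (a, b) + 1"
    using sum_squares_bound[of "\<bar>weight G (a, b)\<bar>" 1] by (simp add: power2_eq_square)
  also have "\<dots> = ?f a b" using ab by simp
  also have "\<dots> \<le> (\<Sum>b<n. ?f a b)"
    by (rule member_le_sum) (use ab f in \<open>auto dest: edge_less\<close>)
  also have "\<dots> \<le> bound"
    unfolding bound_def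
    by (rule member_le_sum[of a "{..<n}" "\<lambda>a. \<Sum>b<n. ?f a b"])
      (use ab f in \<open>auto intro!: sum_nonneg dest: edge_less\<close>)
  also have "\<dots> = M * (1 - l)" using l_less_1 by (simp add: M_def)
  finally have w: "\<bar>weight G (a, b)\<bar> \<le> M - l * M" by (simp add: algebra_simps)
  have "0 \<le> bound" unfolding bound_def by (intro sum_nonneg f)
  then have "0 \<le> M" using l_less_1 by (simp add: M_def)
  then have "0 \<le> l * M" using l_pos by simp
  then show "0 \<le> slack (\<lambda>a. sg a * (bound / (1 - l))) a b"
    using w unfolding slack_def M_def[symmetric]
    by (cases rule: sg_cases[of a]; cases rule: sg_cases[of b]) auto
qed

end

section \<open>Total correctness with time and space bounds\<close>

abbreviation ivar :: "nat \<Rightarrow> iexp" where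
  "ivar v \<equiv> IGet v IZero IZero"

definition For :: "nat \<Rightarrow> com \<Rightarrow> com" where
  "For v c = Seq (ISet v IZero IZero IZero)
     (While (ILess (ivar v) (ivar 0)) (Seq c (ISet v IZero IZero (ISuc (ivar v)))))"

text \<open>One set of cells for the whole run, so that sequencing costs no space. Indices include
  \<open>n\<close>, because the scalars in row 0 and column 0 must be present even if
  \<open>n = 0\<close>.\<close>

definition cells :: "nat \<Rightarrow> cell set" where
  "cells n = Int_Cell ` ({..6} \<times> {..n} \<times> {..n}) \<union> Real_Cell ` ({..6} \<times> {..n} \<times> {..n})"

lemma cells_iff [simp]:
  "Int_Cell (A, i, j) \<in> cells n \<longleftrightarrow> A \<le> 6 \<and> i \<le> n \<and> j \<le> n"
  "Real_Cell (A, i, j) \<in> cells n \<longleftrightarrow> A \<le> 6 \<and> i \<le> n \<and> j \<le> n"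
  by (auto simp: cells_def)

lemma card_cells: "card (cells n) \<le> 14 * (n + 1) ^ 2"
proof -
  have "card (cells n) \<le> card (Int_Cell ` ({..6} \<times> {..n} \<times> {..n}))
      + card (Real_Cell ` ({..6} \<times> {..n} \<times> {..n}))"
    unfolding cells_def by (rule card_Un_le)
  also have "\<dots> \<le> card ({..6::nat} \<times> {..n} \<times> {..n}) + card ({..6::nat} \<times> {..n} \<times> {..n})"
    by (intro add_mono card_image_le) auto
  finally show ?thesis by (simp add: card_cartesian_product power2_eq_square)
qed

text \<open>A Hoare triple for total correctness with time and footprint. Coefficient and degree are
  separate arguments, which reduces the bookkeeping of running times to arithmetic on
  numerals.\<close>

definition triple :: "nat \<Rightarrow> (state \<Rightarrow> bool) \<Rightarrow> com \<Rightarrow> nat \<Rightarrow> nat \<Rightarrow> (state \<Rightarrow> bool) \<Rightarrow> bool" where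
  "triple n P c T k Q \<longleftrightarrow> (\<forall>s. P s \<longrightarrow>
     (\<exists>\<tau> F t. exec c s \<tau> F t \<and> \<tau> \<le> T * (n + 1) ^ k \<and> F \<subseteq> cells n \<and> Q t))"

lemma tripleD:
  assumes "triple n P c T k Q" "P s"
  obtains \<tau> F t where "exec c s \<tau> F t" "\<tau> \<le> T * (n + 1) ^ k" "F \<subseteq> cells n" "Q t"
  using assms by (auto simp: triple_def)

lemma triple_Skip:
  assumes "\<And>s. P s \<Longrightarrow> Q s" "1 \<le> T"
  shows "triple n P Skip T 0 Q"
  unfolding triple_def
proof (intro allI impI)
  fix s assume "P s"
  then show "\<exists>\<tau> F t. exec Skip s \<tau> F t \<and> \<tau> \<le> T * (n + 1) ^ 0 \<and> F \<subseteq> cells n \<and> Q t"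
    using assms exec.Skip[of s] by (intro exI[of _ 1] exI[of _ "{}"] exI[of _ s]) auto
qed

lemma triple_ISet:
  assumes "\<And>s. P s \<Longrightarrow> Q (s\<lparr>imem := (imem s)((A, ival e s, ival f s) := ival g s)\<rparr>)"
    and "\<And>s. P s \<Longrightarrow> insert (Int_Cell (A, ival e s, ival f s)) (icells e s \<union> icells f s \<union> icells g s) \<subseteq> cells n"
    and "itime e + itime f + itime g + 1 \<le> T"
  shows "triple n P (ISet A e f g) T 0 Q"
  unfolding triple_def
proof (intro allI impI)
  fix s assume "P s"
  then show "\<exists>\<tau> F t. exec (ISet A e f g) s \<tau> F t \<and> \<tau> \<le> T * (n + 1) ^ 0 \<and> F \<subseteq> cells n \<and> Q t"
    using assms exec.ISet[OF refl, of A e f g s] by fastforce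
qed

lemma triple_RSet:
  assumes "\<And>s. P s \<Longrightarrow> Q (s\<lparr>rmem := (rmem s)((A, ival e s, ival f s) := rval g s)\<rparr>)"
    and "\<And>s. P s \<Longrightarrow> insert (Real_Cell (A, ival e s, ival f s)) (icells e s \<union> icells f s \<union> rcells g s) \<subseteq> cells n"
    and "itime e + itime f + rtime g + 1 \<le> T"
  shows "triple n P (RSet A e f g) T 0 Q"
  unfolding triple_def
proof (intro allI impI)
  fix s assume "P s"
  then show "\<exists>\<tau> F t. exec (RSet A e f g) s \<tau> F t \<and> \<tau> \<le> T * (n + 1) ^ 0 \<and> F \<subseteq> cells n \<and> Q t"
    using assms exec.RSet[OF refl, of A e f g s] by fastforce
qed

lemma time_mono:
  fixes T U k m n :: nat
  assumes "T \<le> U" "k \<le> m"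
  shows "T * (n + 1) ^ k \<le> U * (n + 1) ^ m"
  using assms by (intro mult_mono power_increasing) auto

lemma triple_Seq:
  assumes c: "triple n P c T k R" and d: "triple n R d U m Q" and "T + U \<le> V" "k \<le> j" "m \<le> j"
  shows "triple n P (Seq c d) V j Q"
  unfolding triple_def
proof (intro allI impI)
  fix s assume "P s"
  with c obtain \<tau> F s' where 1: "exec c s \<tau> F s'" "\<tau> \<le> T * (n + 1) ^ k" "F \<subseteq> cells n" "R s'"
    by (rule tripleD)
  from d 1(4) obtain \<rho> E t where 2: "exec d s' \<rho> E t" "\<rho> \<le> U * (n + 1) ^ m" "E \<subseteq> cells n" "Q t"
    by (rule tripleD)
  have "\<tau> + \<rho> \<le> T * (n + 1) ^ j + U * (n + 1) ^ j"
    using 1(2) 2(2) time_mono[of T T k j n] time_mono[of U U m j n] assms(4,5) by linarith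
  also have "\<dots> \<le> V * (n + 1) ^ j"
    using assms(3) by (metis add_mult_distrib mult_le_mono1)
  finally show "\<exists>\<tau> F t. exec (Seq c d) s \<tau> F t \<and> \<tau> \<le> V * (n + 1) ^ j \<and> F \<subseteq> cells n \<and> Q t"
    using exec.Seq[OF 1(1) 2(1)] 1(3) 2(3,4) by blast
qed

lemma triple_conseq:
  assumes "triple n P c T k Q" "\<And>s. P' s \<Longrightarrow> P s" "\<And>s. Q s \<Longrightarrow> Q' s"
  shows "triple n P' c T k Q'"
  using assms unfolding triple_def by metis

lemma triple_Cond:
  assumes c: "triple n (\<lambda>s. P s \<and> bval b s) c T 0 Q"
    and d: "triple n (\<lambda>s. P s \<and> \<not> bval b s) d T 0 Q"
    and "\<And>s. P s \<Longrightarrow> bcells b s \<subseteq> cells n" and "btime b + T + 1 \<le> U"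
  shows "triple n P (Cond b c d) U 0 Q"
  unfolding triple_def
proof (intro allI impI)
  fix s assume P: "P s"
  show "\<exists>\<tau> F t. exec (Cond b c d) s \<tau> F t \<and> \<tau> \<le> U * (n + 1) ^ 0 \<and> F \<subseteq> cells n \<and> Q t"
  proof (cases "bval b s")
    case True
    then obtain \<tau> F t where 1: "exec c s \<tau> F t" "\<tau> \<le> T * (n + 1) ^ 0" "F \<subseteq> cells n" "Q t"
      using c P by (elim tripleD[where s = s]) auto
    have "btime b + \<tau> + 1 \<le> U * (n + 1) ^ 0" using 1(2) assms(4) by simp
    then show ?thesis using exec.Cond_True[OF True 1(1), of d] 1(3,4) assms(3)[OF P] by blast
  next
    case False
    then obtain \<tau> F t where 1: "exec d s \<tau> F t" "\<tau> \<le> T * (n + 1) ^ 0" "F \<subseteq> cells n" "Q t"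
      using d P by (elim tripleD[where s = s]) auto
    have "btime b + \<tau> + 1 \<le> U * (n + 1) ^ 0" using 1(2) assms(4) by simp
    then show ?thesis using exec.Cond_False[OF False 1(1), of c] 1(3,4) assms(3)[OF P] by blast
  qed
qed

text \<open>Stated with \<open>exec\<close> instead of \<open>triple\<close>, because the number of
  rounds depends on the initial state and need not be polynomial in \<open>n\<close>. The added 1
  pays for the final test.\<close>

lemma exec_While_measure:
  fixes m :: "state \<Rightarrow> nat"
  assumes body: "\<And>i. triple n (\<lambda>s. I s \<and> bval b s \<and> m s = i) c T k (\<lambda>s. I s \<and> m s < i)"
    and guard: "\<And>s. I s \<Longrightarrow> bcells b s \<subseteq> cells n"
    and "I s"
  shows "\<exists>\<tau> F t. exec (While b c) s \<tau> F t \<and> \<tau> \<le> (m s + 1) * (T * (n + 1) ^ k + btime b + 1) \<and>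
    F \<subseteq> cells n \<and> I t \<and> \<not> bval b t"
  using \<open>I s\<close>
proof (induction "m s" arbitrary: s rule: less_induct)
  case less
  let ?U = "T * (n + 1) ^ k + btime b + 1"
  show ?case
  proof (cases "bval b s")
    case True
    obtain \<tau> F s' where 1: "exec c s \<tau> F s'" "\<tau> \<le> T * (n + 1) ^ k" "F \<subseteq> cells n" "I s'" "m s' < m s"
      using tripleD[OF body[of "m s"], of s] True less.prems by blast
    obtain \<rho> E t where 2: "exec (While b c) s' \<rho> E t" "\<rho> \<le> (m s' + 1) * ?U" "E \<subseteq> cells n"
      "I t" "\<not> bval b t"
      using less.hyps[OF 1(5,4)] by blast
    have "(m s' + 1) * ?U \<le> m s * ?U" using 1(5) by (intro mult_le_mono1) simp
    then have "btime b + \<tau> + \<rho> + 1 \<le> ?U + m s * ?U" using 1(2) 2(2) by linarith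
    then have "btime b + \<tau> + \<rho> + 1 \<le> (m s + 1) * ?U" by simp
    moreover have "bcells b s \<union> F \<union> E \<subseteq> cells n" using guard less.prems 1(3) 2(3) by blast
    ultimately show ?thesis using exec.While_True[OF True 1(1) 2(1)] 2(4,5) by blast
  next
    case False
    have "btime b + 1 \<le> (m s + 1) * ?U" by simp
    then show ?thesis
      using exec.While_False[OF False, of c] guard[OF less.prems] less.prems False by blast
  qed
qed

text \<open>The body has to establish \<open>J (Suc i)\<close> for the state with the counter
  already advanced, so the increment that \<open>For\<close> appends needs no treatment of its
  own.\<close>

lemma triple_For:
  assumes v: "0 < v" "v \<le> 6"
    and start: "\<And>s. P s \<Longrightarrow> imem s (0, 0, 0) = n \<and> J 0 (s\<lparr>imem := (imem s)((v, 0, 0) := 0)\<rparr>)"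
    and body: "\<And>i. i < n \<Longrightarrow>
      triple n (\<lambda>s. J i s \<and> imem s (v, 0, 0) = i \<and> imem s (0, 0, 0) = n) c T k
        (\<lambda>s. J (Suc i) (s\<lparr>imem := (imem s)((v, 0, 0) := Suc i)\<rparr>) \<and>
          imem s (v, 0, 0) = i \<and> imem s (0, 0, 0) = n)"
    and finish: "\<And>s. J n s \<Longrightarrow> imem s (0, 0, 0) = n \<Longrightarrow> Q s"
    and time: "T + 20 \<le> U" "k + 1 = j"
  shows "triple n P (For v c) U j Q"
  unfolding triple_def
proof (intro allI impI)
  fix s assume "P s"
  let ?s = "s\<lparr>imem := (imem s)((v, 0, 0) := 0)\<rparr>"
  let ?b = "ILess (ivar v) (ivar 0)" and ?c = "Seq c (ISet v IZero IZero (ISuc (ivar v)))"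
  define I where "I s \<longleftrightarrow> imem s (0, 0, 0) = n \<and> imem s (v, 0, 0) \<le> n \<and> J (imem s (v, 0, 0)) s" for s
  define m where "m s = n - imem s (v, 0, 0)" for s :: state
  have 1: "exec (ISet v IZero IZero IZero) s 4 {Int_Cell (v, 0, 0)} ?s"
    using exec.ISet[OF refl, of v IZero IZero IZero s] by (simp add: numeral_eq_Suc)
  have I: "I ?s" using start[OF \<open>P s\<close>] v by (simp add: I_def)
  have body': "triple n (\<lambda>s. I s \<and> bval ?b s \<and> m s = i) ?c (T + 7) k (\<lambda>s. I s \<and> m s < i)" for i
    unfolding triple_def
  proof (intro allI impI)
    fix s assume s: "I s \<and> bval ?b s \<and> m s = i"
    let ?i = "imem s (v, 0, 0)"
    have i: "?i < n" using s by (simp add: I_def)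
    have "triple n (\<lambda>s. J ?i s \<and> imem s (v, 0, 0) = ?i \<and> imem s (0, 0, 0) = n) ?c (T + 7) k
       (\<lambda>s. J (Suc ?i) s \<and> imem s (v, 0, 0) = Suc ?i \<and> imem s (0, 0, 0) = n)"
      by (rule triple_Seq[OF body[OF i] triple_ISet]) (use v in auto)
    then obtain \<tau> F t where "exec ?c s \<tau> F t" "\<tau> \<le> (T + 7) * (n + 1) ^ k" "F \<subseteq> cells n"
      "J (Suc ?i) t" "imem t (v, 0, 0) = Suc ?i" "imem t (0, 0, 0) = n"
      using s by (elim tripleD[where s = s]) (auto simp: I_def)
    moreover from this have "I t \<and> m t < i" using s i by (auto simp: I_def m_def)
    ultimately show "\<exists>\<tau> F t. exec ?c s \<tau> F t \<and> \<tau> \<le> (T + 7) * (n + 1) ^ k \<and> F \<subseteq> cells n \<and>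
      I t \<and> m t < i" by blast
  qed
  obtain \<rho> E t where 2: "exec (While ?b ?c) ?s \<rho> E t"
    "\<rho> \<le> (m ?s + 1) * ((T + 7) * (n + 1) ^ k + btime ?b + 1)" "E \<subseteq> cells n" "I t" "\<not> bval ?b t"
    using exec_While_measure[of n I ?b m ?c "T + 7" k ?s, OF body' _ I] v by auto
  have "imem t (v, 0, 0) = n" using 2(4,5) by (auto simp: I_def)
  then have Q: "Q t" using finish 2(4) by (simp add: I_def)
  have "1 \<le> (n + 1) ^ k" by simp
  \<comment> \<open>The increment costs 7 per round, the test 8, and the initialisation 4 once; the
    allowance of 20 per round covers all three.\<close>
  moreover have "btime ?b + 1 + 4 = 12" by simp
  ultimately have "btime ?b + 1 + 4 \<le> 13 * (n + 1) ^ k" by linarith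
  then have "(T + 7) * (n + 1) ^ k + btime ?b + 1 + 4 \<le> (T + 20) * (n + 1) ^ k"
    by (simp add: algebra_simps)
  then have "(n + 1) * ((T + 7) * (n + 1) ^ k + btime ?b + 1 + 4) \<le> (n + 1) * ((T + 20) * (n + 1) ^ k)"
    by (rule mult_le_mono2)
  also have "\<dots> \<le> U * (n + 1) ^ j"
    using time_mono[of "T + 20" U j j n] time by (auto simp: algebra_simps)
  finally have "4 + \<rho> \<le> U * (n + 1) ^ j"
    using 2(2) by (simp add: m_def algebra_simps)
  then show "\<exists>\<tau> F t. exec (For v c) s \<tau> F t \<and> \<tau> \<le> U * (n + 1) ^ j \<and> F \<subseteq> cells n \<and> Q t"
    using exec.Seq[OF 1 2(1)] 2(3) Q v unfolding For_def
    by (intro exI[of _ "4 + \<rho>"] exI[of _ "{Int_Cell (v, 0, 0)} \<union> E"] exI[of _ t]) auto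
qed

section \<open>The program\<close>

text \<open>Integer variables: 3 and 4 run through the nodes, 5 counts rounds of value iteration. Real
  arrays: 2 is the current point, 3 the shift, 4 its next iterate, 6 the signs of the nodes; the cell
  \<open>(5, 0, 0)\<close> first holds the sum that bounds the weights and then the speed.\<close>

abbreviation "eslack \<equiv> RMul (RGet 6 (ivar 3) IZero) (RSub (RGet 2 (ivar 3) IZero)
  (RAdd (RGet 1 (ivar 3) (ivar 4)) (RMul (RGet 0 IZero IZero) (RGet 2 (ivar 4) IZero))))"

abbreviation "eratio \<equiv> RDiv (RMul (RGet 6 (ivar 3) IZero)
  (RSub (RMul (RGet 0 IZero IZero) (RGet 3 (ivar 4) IZero)) (RGet 3 (ivar 3) IZero))) eslack"

definition init_signs :: com where
  "init_signs = For 3 (Cond (ILess IZero (IGet 1 (ivar 3) IZero))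
     (RSet 6 (ivar 3) IZero ROne) (RSet 6 (ivar 3) IZero (RSub RZero ROne)))"

definition init_bound :: com where
  "init_bound = Seq (RSet 5 IZero IZero RZero)
     (For 3 (For 4 (RSet 5 IZero IZero (RAdd (RGet 5 IZero IZero)
       (RAdd (RMul (RGet 1 (ivar 3) (ivar 4)) (RGet 1 (ivar 3) (ivar 4))) ROne)))))"

text \<open>The last assignment replaces the bound by a positive dummy speed, so that the main loop
  is entered.\<close>

definition init_point :: com where
  "init_point = Seq (For 3 (RSet 2 (ivar 3) IZero (RMul (RGet 6 (ivar 3) IZero)
     (RDiv (RGet 5 IZero IZero) (RSub ROne (RGet 0 IZero IZero))))))
     (RSet 5 IZero IZero ROne)"

definition zero_shift :: com where
  "zero_shift = For 3 (RSet 3 (ivar 3) IZero RZero)"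

text \<open>The initial value is the option -1. Slack 0 is tested by two negated strict comparisons.
  Results go to array 4, so that all nodes are updated from the same iterate.\<close>

definition backup_node :: com where
  "backup_node = Seq (RSet 4 (ivar 3) IZero (RSub RZero (RGet 6 (ivar 3) IZero)))
     (For 4 (Cond (BAnd (ILess IZero (IGet 2 (ivar 3) (ivar 4)))
         (BAnd (BNot (RLess eslack RZero)) (BAnd (BNot (RLess RZero eslack))
           (RLess (RMul (RGet 6 (ivar 3) IZero) (RGet 4 (ivar 3) IZero))
             (RMul (RGet 6 (ivar 3) IZero) (RMul (RGet 0 IZero IZero) (RGet 3 (ivar 4) IZero)))))))
       (RSet 4 (ivar 3) IZero (RMul (RGet 0 IZero IZero) (RGet 3 (ivar 4) IZero)))
       Skip))"

definition backup_all :: com where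
  "backup_all = Seq (For 3 backup_node) (For 3 (RSet 3 (ivar 3) IZero (RGet 4 (ivar 3) IZero)))"

definition find_speed :: com where
  "find_speed = Seq (RSet 5 IZero IZero RZero)
     (For 3 (For 4 (Cond (BAnd (ILess IZero (IGet 2 (ivar 3) (ivar 4)))
         (RLess (RGet 5 IZero IZero) eratio))
       (RSet 5 IZero IZero eratio) Skip)))"

definition move_point :: com where
  "move_point = For 3 (RSet 2 (ivar 3) IZero (RAdd (RGet 2 (ivar 3) IZero)
     (RDiv (RGet 3 (ivar 3) IZero) (RGet 5 IZero IZero))))"

text \<open>The last pass through the loop has speed \<open>0\<close> and leaves the point alone, since \<open>y / 0 = 0\<close>.\<close>

definition main_body :: com where
  "main_body = Seq zero_shift (Seq (For 5 backup_all) (Seq find_speed move_point))"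

definition program :: com where
  "program = Seq init_signs (Seq init_bound (Seq init_point
     (While (RLess RZero (RGet 5 IZero IZero)) main_body)))"

section \<open>Verification of the parts of the program\<close>

context game
begin

text \<open>A predicate on the two memory functions instead of on states, so that rewriting with
  function updates disposes of writes to other arrays.\<close>

definition input_mem :: "(addr \<Rightarrow> nat) \<Rightarrow> (addr \<Rightarrow> real) \<Rightarrow> bool" where
  "input_mem f g \<longleftrightarrow> f (0, 0, 0) = n \<and>
     (\<forall>a<n. 0 < f (1, a, 0) \<longleftrightarrow> a \<in> max_nodes G) \<and>
     (\<forall>a<n. \<forall>b<n. 0 < f (2, a, b) \<longleftrightarrow> (a, b) \<in> edges G) \<and>
     g (0, 0, 0) = l \<and>
     (\<forall>a<n. \<forall>b<n. g (1, a, b) = (if (a, b) \<in> edges G then weight G (a, b) else 0))"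

definition arr_mem :: "nat \<Rightarrow> nat \<Rightarrow> (nat \<Rightarrow> real) \<Rightarrow> (addr \<Rightarrow> real) \<Rightarrow> bool" where
  "arr_mem A k y g \<longleftrightarrow> (\<forall>a<k. g (A, a, 0) = y a)"

definition col_mem :: "nat \<Rightarrow> (addr \<Rightarrow> real) \<Rightarrow> nat \<Rightarrow> real" where
  "col_mem A g = (\<lambda>a. g (A, a, 0))"

abbreviation "inp s \<equiv> input_mem (imem s) (rmem s)"
abbreviation "arr A k y s \<equiv> arr_mem A k y (rmem s)"
abbreviation "col A s \<equiv> col_mem A (rmem s)"

lemma input_mem_imem [simp]: "3 \<le> v \<Longrightarrow> input_mem (f((v, i, j) := k)) g = input_mem f g"
  by (simp add: input_mem_def)

lemma input_mem_rmem [simp]: "2 \<le> A \<Longrightarrow> input_mem f (g((A, i, j) := y)) = input_mem f g"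
  by (simp add: input_mem_def)

lemma arr_mem_other [simp]: "A \<noteq> B \<Longrightarrow> arr_mem A k y (g((B, i, j) := z)) = arr_mem A k y g"
  by (simp add: arr_mem_def)

lemma arr_mem_0 [simp]: "arr_mem A 0 y g"
  by (simp add: arr_mem_def)

lemma arr_mem_Suc [simp]: "arr_mem A (Suc k) y (g((A, k, 0) := z)) \<longleftrightarrow> arr_mem A k y g \<and> z = y k"
  by (auto simp: arr_mem_def less_Suc_eq)

lemma arr_mem_same [simp]: "arr_mem A k y (g((A, k, j) := z)) \<longleftrightarrow> arr_mem A k y g"
  by (simp add: arr_mem_def)

lemma arrD: "arr_mem A k y g \<Longrightarrow> a < k \<Longrightarrow> g (A, a, 0) = y a"
  by (simp add: arr_mem_def)

lemma col_mem_other [simp]: "A \<noteq> B \<Longrightarrow> col_mem A (g((B, i, j) := z)) = col_mem A g"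
  by (simp add: col_mem_def)

lemma inpD:
  assumes "input_mem f g"
  shows "f (0, 0, 0) = n"
    "a < n \<Longrightarrow> 0 < f (Suc 0, a, 0) \<longleftrightarrow> a \<in> max_nodes G"
    "a < n \<Longrightarrow> f (Suc 0, a, 0) = 0 \<longleftrightarrow> a \<notin> max_nodes G"
    "a < n \<Longrightarrow> b < n \<Longrightarrow> 0 < f (2, a, b) \<longleftrightarrow> (a, b) \<in> edges G"
    "a < n \<Longrightarrow> b < n \<Longrightarrow> f (2, a, b) = 0 \<longleftrightarrow> (a, b) \<notin> edges G"
    "g (0, 0, 0) = l"
    "a < n \<Longrightarrow> b < n \<Longrightarrow> g (Suc 0, a, b) = (if (a, b) \<in> edges G then weight G (a, b) else 0)"
  using assms unfolding input_mem_def One_nat_def by (metis neq0_conv)+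

lemma init_signs: "triple n inp init_signs 120 1 (\<lambda>s. inp s \<and> arr 6 n sg s)"
  unfolding init_signs_def
proof (rule triple_For[where J = "\<lambda>i s. inp s \<and> arr 6 i sg s" and T = 100 and k = 0])
  fix i assume i: "i < n"
  show "triple n (\<lambda>s. (inp s \<and> arr 6 i sg s) \<and> imem s (3, 0, 0) = i \<and> imem s (0, 0, 0) = n)
    (Cond (ILess IZero (IGet 1 (ivar 3) IZero))
     (RSet 6 (ivar 3) IZero ROne) (RSet 6 (ivar 3) IZero (RSub RZero ROne))) 100 0
    (\<lambda>s. (inp (s\<lparr>imem := (imem s)((3, 0, 0) := Suc i)\<rparr>) \<and>
        arr 6 (Suc i) sg (s\<lparr>imem := (imem s)((3, 0, 0) := Suc i)\<rparr>)) \<and>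
      imem s (3, 0, 0) = i \<and> imem s (0, 0, 0) = n)"
    by (rule triple_Cond[where T = 50]; (rule triple_RSet)?)
      (use i in \<open>auto simp: inpD sg_def\<close>)
qed (auto simp: inpD)

abbreviation wsum :: "nat \<Rightarrow> nat \<Rightarrow> real" where
  "wsum a b \<equiv> (if (a, b) \<in> edges G then weight G (a, b) * weight G (a, b) + 1 else 1)"

lemma init_bound:
  "triple n (\<lambda>s. inp s \<and> arr 6 n sg s) init_bound 240 2
     (\<lambda>s. inp s \<and> arr 6 n sg s \<and> rmem s (5, 0, 0) = bound)"
  unfolding init_bound_def
proof (rule triple_Seq)
  show "triple n (\<lambda>s. inp s \<and> arr 6 n sg s) (RSet 5 IZero IZero RZero) 100 0
     (\<lambda>s. inp s \<and> arr 6 n sg s \<and> rmem s (5, 0, 0) = 0)"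
    by (rule triple_RSet) auto
  let ?J = "\<lambda>i s. inp s \<and> arr 6 n sg s \<and> rmem s (5, 0, 0) = (\<Sum>a<i. \<Sum>b<n. wsum a b)"
  let ?J' = "\<lambda>i j s. inp s \<and> arr 6 n sg s \<and> imem s (3, 0, 0) = i \<and>
    rmem s (5, 0, 0) = (\<Sum>a<i. \<Sum>b<n. wsum a b) + (\<Sum>b<j. wsum i b)"
  show "triple n (\<lambda>s. inp s \<and> arr 6 n sg s \<and> rmem s (5, 0, 0) = 0)
    (For 3 (For 4 (RSet 5 IZero IZero (RAdd (RGet 5 IZero IZero)
       (RAdd (RMul (RGet 1 (ivar 3) (ivar 4)) (RGet 1 (ivar 3) (ivar 4))) ROne))))) 140 2
     (\<lambda>s. inp s \<and> arr 6 n sg s \<and> rmem s (5, 0, 0) = bound)"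
  proof (rule triple_For[where J = ?J and T = 120 and k = 1])
    fix i assume i: "i < n"
    show "triple n (\<lambda>s. ?J i s \<and> imem s (3, 0, 0) = i \<and> imem s (0, 0, 0) = n)
      (For 4 (RSet 5 IZero IZero (RAdd (RGet 5 IZero IZero)
        (RAdd (RMul (RGet 1 (ivar 3) (ivar 4)) (RGet 1 (ivar 3) (ivar 4))) ROne)))) 120 1
      (\<lambda>s. ?J (Suc i) (s\<lparr>imem := (imem s)((3, 0, 0) := Suc i)\<rparr>) \<and>
         imem s (3, 0, 0) = i \<and> imem s (0, 0, 0) = n)"
    proof (rule triple_For[where J = "?J' i" and T = 100 and k = 0])
      fix j assume j: "j < n"
      show "triple n (\<lambda>s. ?J' i j s \<and> imem s (4, 0, 0) = j \<and> imem s (0, 0, 0) = n)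
        (RSet 5 IZero IZero (RAdd (RGet 5 IZero IZero)
          (RAdd (RMul (RGet 1 (ivar 3) (ivar 4)) (RGet 1 (ivar 3) (ivar 4))) ROne))) 100 0
        (\<lambda>s. ?J' i (Suc j) (s\<lparr>imem := (imem s)((4, 0, 0) := Suc j)\<rparr>) \<and>
           imem s (4, 0, 0) = j \<and> imem s (0, 0, 0) = n)"
        by (rule triple_RSet) (use i j in \<open>auto simp: inpD\<close>)
    qed (auto simp: inpD)
  qed (auto simp: inpD bound_def)
qed auto

definition start :: "nat \<Rightarrow> real" where
  "start a = sg a * (bound / (1 - l))"

lemma init_point:
  "triple n (\<lambda>s. inp s \<and> arr 6 n sg s \<and> rmem s (5, 0, 0) = bound) init_point 220 1
     (\<lambda>s. inp s \<and> arr 6 n sg s \<and> arr 2 n start s \<and> rmem s (5, 0, 0) = 1)"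
  unfolding init_point_def
proof (rule triple_Seq)
  let ?J = "\<lambda>i s. inp s \<and> arr 6 n sg s \<and> arr 2 i start s \<and> rmem s (5, 0, 0) = bound"
  show "triple n (\<lambda>s. inp s \<and> arr 6 n sg s \<and> rmem s (5, 0, 0) = bound)
    (For 3 (RSet 2 (ivar 3) IZero (RMul (RGet 6 (ivar 3) IZero)
     (RDiv (RGet 5 IZero IZero) (RSub ROne (RGet 0 IZero IZero)))))) 120 1 (?J n)"
  proof (rule triple_For[where J = ?J and T = 100 and k = 0])
    fix i assume i: "i < n"
    show "triple n (\<lambda>s. ?J i s \<and> imem s (3, 0, 0) = i \<and> imem s (0, 0, 0) = n)
      (RSet 2 (ivar 3) IZero (RMul (RGet 6 (ivar 3) IZero)
        (RDiv (RGet 5 IZero IZero) (RSub ROne (RGet 0 IZero IZero))))) 100 0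
      (\<lambda>s. ?J (Suc i) (s\<lparr>imem := (imem s)((3, 0, 0) := Suc i)\<rparr>) \<and>
         imem s (3, 0, 0) = i \<and> imem s (0, 0, 0) = n)"
      by (rule triple_RSet) (use i in \<open>auto simp: inpD arrD start_def\<close>)
  qed (auto simp: inpD)
  show "triple n (?J n) (RSet 5 IZero IZero ROne) 100 0
    (\<lambda>s. inp s \<and> arr 6 n sg s \<and> arr 2 n start s \<and> rmem s (5, 0, 0) = 1)"
    by (rule triple_RSet) auto
qed auto

text \<open>The point is the whole column, rows beyond the nodes included. The main loop leaves
  those rows alone, which fits \<open>move\<close> because the shift vanishes there.\<close>

definition ctx_mem :: "(nat \<Rightarrow> real) \<Rightarrow> (addr \<Rightarrow> nat) \<Rightarrow> (addr \<Rightarrow> real) \<Rightarrow> bool" where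
  "ctx_mem x f g \<longleftrightarrow> input_mem f g \<and> arr_mem 6 n sg g \<and> col_mem 2 g = x"

abbreviation "ctx x s \<equiv> ctx_mem x (imem s) (rmem s)"

lemma ctx_mem_imem [simp]: "3 \<le> v \<Longrightarrow> ctx_mem x (f((v, i, j) := k)) g = ctx_mem x f g"
  by (simp add: ctx_mem_def)

lemma ctx_mem_rmem [simp]: "3 \<le> A \<Longrightarrow> A < 6 \<Longrightarrow> ctx_mem x f (g((A, i, j) := y)) = ctx_mem x f g"
  by (simp add: ctx_mem_def)

lemma ctxD:
  assumes "ctx_mem x f g"
  shows "f (0, 0, 0) = n" "a < n \<Longrightarrow> g (6, a, 0) = sg a" "g (2, a, 0) = x a"
    "a < n \<Longrightarrow> b < n \<Longrightarrow> 0 < f (2, a, b) \<longleftrightarrow> (a, b) \<in> edges G"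
    "a < n \<Longrightarrow> b < n \<Longrightarrow> f (2, a, b) = 0 \<longleftrightarrow> (a, b) \<notin> edges G"
    "g (0, 0, 0) = l"
    "a < n \<Longrightarrow> b < n \<Longrightarrow> g (Suc 0, a, b) = (if (a, b) \<in> edges G then weight G (a, b) else 0)"
  using assms by (auto simp: ctx_mem_def inpD arrD col_mem_def)

lemma zero_shift: "triple n (ctx x) zero_shift 120 1 (\<lambda>s. ctx x s \<and> arr 3 n (backups x 0) s)"
  unfolding zero_shift_def
proof (rule triple_For[where J = "\<lambda>i s. ctx x s \<and> arr 3 i (backups x 0) s" and T = 100 and k = 0])
  fix i assume i: "i < n"
  show "triple n (\<lambda>s. (ctx x s \<and> arr 3 i (backups x 0) s) \<and> imem s (3, 0, 0) = i \<and> imem s (0, 0, 0) = n)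
    (RSet 3 (ivar 3) IZero RZero) 100 0
    (\<lambda>s. (ctx x (s\<lparr>imem := (imem s)((3, 0, 0) := Suc i)\<rparr>) \<and>
      arr 3 (Suc i) (backups x 0) (s\<lparr>imem := (imem s)((3, 0, 0) := Suc i)\<rparr>)) \<and>
      imem s (3, 0, 0) = i \<and> imem s (0, 0, 0) = n)"
    by (rule triple_RSet) (use i in auto)
qed (auto simp: ctxD)

definition partial_backup :: "(nat \<Rightarrow> real) \<Rightarrow> (nat \<Rightarrow> real) \<Rightarrow> nat \<Rightarrow> nat \<Rightarrow> real" where
  "partial_backup x v a j = sg a * Max (insert (- 1) ((\<lambda>b. sg a * (l * v b)) ` {b. b < j \<and> tight x a b}))"

lemma partial_backup_0: "partial_backup x v a 0 = - sg a"
  by (simp add: partial_backup_def)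

lemma partial_backup_Suc:
  "partial_backup x v a (Suc j) =
    (if tight x a j \<and> sg a * partial_backup x v a j < sg a * (l * v j) then l * v j
     else partial_backup x v a j)"
proof -
  define M where "M j = Max (insert (- 1) ((\<lambda>b. sg a * (l * v b)) ` {b. b < j \<and> tight x a b}))" for j
  have M: "partial_backup x v a j = sg a * M j" for j by (simp only: partial_backup_def M_def)
  show ?thesis
  proof (cases "tight x a j")
    case True
    then have "{b. b < Suc j \<and> tight x a b} = insert j {b. b < j \<and> tight x a b}"
      by (auto simp: less_Suc_eq)
    then have "M (Suc j) = Max (insert (sg a * (l * v j))
        (insert (- 1) ((\<lambda>b. sg a * (l * v b)) ` {b. b < j \<and> tight x a b})))"
      by (simp only: M_def image_insert insert_commute)
    also have "\<dots> = max (sg a * (l * v j)) (M j)" unfolding M_def by (rule Max_insert) auto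
    finally show ?thesis using True by (simp add: M max_def)
  next
    case False
    then have "{b. b < Suc j \<and> tight x a b} = {b. b < j \<and> tight x a b}"
      by (auto simp: less_Suc_eq)
    then show ?thesis using False by (simp add: partial_backup_def)
  qed
qed

lemma partial_backup_n:
  assumes "a < n"
  shows "partial_backup x v a n = backup x v a"
proof -
  have "{b. b < n \<and> tight x a b} = {b. tight x a b}" by (auto simp: tight_def dest: edge_less)
  then show ?thesis using assms by (simp add: partial_backup_def backup_def)
qed

lemma backup_node:
  assumes i: "i < n"
  shows "triple n (\<lambda>s. ctx x s \<and> arr 3 n v s \<and> arr 4 i (backup x v) s \<and>
      imem s (3, 0, 0) = i \<and> imem s (5, 0, 0) = t) backup_node 320 1
    (\<lambda>s. ctx x s \<and> arr 3 n v s \<and> arr 4 (Suc i) (backup x v) s \<and>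
      imem s (3, 0, 0) = i \<and> imem s (5, 0, 0) = t)"
  unfolding backup_node_def
proof (rule triple_Seq)
  let ?J = "\<lambda>j s. ctx x s \<and> arr 3 n v s \<and> arr 4 i (backup x v) s \<and>
      imem s (3, 0, 0) = i \<and> imem s (5, 0, 0) = t \<and> rmem s (4, i, 0) = partial_backup x v i j"
  show "triple n (\<lambda>s. ctx x s \<and> arr 3 n v s \<and> arr 4 i (backup x v) s \<and>
      imem s (3, 0, 0) = i \<and> imem s (5, 0, 0) = t)
    (RSet 4 (ivar 3) IZero (RSub RZero (RGet 6 (ivar 3) IZero))) 100 0 (?J 0)"
    by (rule triple_RSet) (use i in \<open>auto simp: ctxD partial_backup_0\<close>)
  show "triple n (?J 0) (For 4 (Cond (BAnd (ILess IZero (IGet 2 (ivar 3) (ivar 4)))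
         (BAnd (BNot (RLess eslack RZero)) (BAnd (BNot (RLess RZero eslack))
           (RLess (RMul (RGet 6 (ivar 3) IZero) (RGet 4 (ivar 3) IZero))
             (RMul (RGet 6 (ivar 3) IZero) (RMul (RGet 0 IZero IZero) (RGet 3 (ivar 4) IZero)))))))
       (RSet 4 (ivar 3) IZero (RMul (RGet 0 IZero IZero) (RGet 3 (ivar 4) IZero)))
       Skip)) 220 1
    (\<lambda>s. ctx x s \<and> arr 3 n v s \<and> arr 4 (Suc i) (backup x v) s \<and>
      imem s (3, 0, 0) = i \<and> imem s (5, 0, 0) = t)"
  proof (rule triple_For[where J = ?J and T = 200 and k = 0])
    fix j assume j: "j < n"
    let ?b = "BAnd (ILess IZero (IGet 2 (ivar 3) (ivar 4)))
         (BAnd (BNot (RLess eslack RZero)) (BAnd (BNot (RLess RZero eslack))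
           (RLess (RMul (RGet 6 (ivar 3) IZero) (RGet 4 (ivar 3) IZero))
             (RMul (RGet 6 (ivar 3) IZero) (RMul (RGet 0 IZero IZero) (RGet 3 (ivar 4) IZero))))))"
    let ?P = "\<lambda>s. ?J j s \<and> imem s (4, 0, 0) = j \<and> imem s (0, 0, 0) = n"
    have b: "bval ?b s \<longleftrightarrow> tight x i j \<and> sg i * partial_backup x v i j < sg i * (l * v j)"
      if "?P s" for s
      using that i j by (auto simp: ctxD arrD tight_def slack_def)
    show "triple n ?P (Cond ?b
       (RSet 4 (ivar 3) IZero (RMul (RGet 0 IZero IZero) (RGet 3 (ivar 4) IZero))) Skip) 200 0
      (\<lambda>s. ?J (Suc j) (s\<lparr>imem := (imem s)((4, 0, 0) := Suc j)\<rparr>) \<and>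
         imem s (4, 0, 0) = j \<and> imem s (0, 0, 0) = n)"
    proof (rule triple_Cond)
      show "triple n (\<lambda>s. ?P s \<and> bval ?b s)
        (RSet 4 (ivar 3) IZero (RMul (RGet 0 IZero IZero) (RGet 3 (ivar 4) IZero))) 50 0
        (\<lambda>s. ?J (Suc j) (s\<lparr>imem := (imem s)((4, 0, 0) := Suc j)\<rparr>) \<and>
         imem s (4, 0, 0) = j \<and> imem s (0, 0, 0) = n)"
      proof (rule triple_RSet)
        fix s assume s: "?P s \<and> bval ?b s"
        then have "partial_backup x v i (Suc j) = l * v j"
          using b[of s] by (simp only: partial_backup_Suc) simp
        then show "?J (Suc j) ((s\<lparr>rmem := (rmem s)((4, ival (ivar 3) s, ival IZero s) :=
            rval (RMul (RGet 0 IZero IZero) (RGet 3 (ivar 4) IZero)) s)\<rparr>)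
            \<lparr>imem := (imem (s\<lparr>rmem := (rmem s)((4, ival (ivar 3) s, ival IZero s) :=
            rval (RMul (RGet 0 IZero IZero) (RGet 3 (ivar 4) IZero)) s)\<rparr>))((4, 0, 0) := Suc j)\<rparr>) \<and>
          imem (s\<lparr>rmem := (rmem s)((4, ival (ivar 3) s, ival IZero s) :=
            rval (RMul (RGet 0 IZero IZero) (RGet 3 (ivar 4) IZero)) s)\<rparr>) (4, 0, 0) = j \<and>
          imem (s\<lparr>rmem := (rmem s)((4, ival (ivar 3) s, ival IZero s) :=
            rval (RMul (RGet 0 IZero IZero) (RGet 3 (ivar 4) IZero)) s)\<rparr>) (0, 0, 0) = n"
          using s j by (auto simp: ctxD arrD simp del: bval.simps)
      qed (use i j in \<open>auto\<close>)
      show "triple n (\<lambda>s. ?P s \<and> \<not> bval ?b s) Skip 50 0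
        (\<lambda>s. ?J (Suc j) (s\<lparr>imem := (imem s)((4, 0, 0) := Suc j)\<rparr>) \<and>
         imem s (4, 0, 0) = j \<and> imem s (0, 0, 0) = n)"
      proof (rule triple_Skip)
        fix s assume s: "?P s \<and> \<not> bval ?b s"
        then have "partial_backup x v i (Suc j) = partial_backup x v i j"
          using b[of s] by (simp only: partial_backup_Suc) simp
        then show "?J (Suc j) (s\<lparr>imem := (imem s)((4, 0, 0) := Suc j)\<rparr>) \<and>
         imem s (4, 0, 0) = j \<and> imem s (0, 0, 0) = n"
          using s by (simp del: bval.simps)
      qed simp
    qed (use i j in auto)
  next
    fix s assume "?J n s" "imem s (0, 0, 0) = n"
    then show "ctx x s \<and> arr 3 n v s \<and> arr 4 (Suc i) (backup x v) s \<and>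
      imem s (3, 0, 0) = i \<and> imem s (5, 0, 0) = t"
      using partial_backup_n[OF i] by (auto simp: arr_mem_def less_Suc_eq)
  qed (auto simp: ctxD)
qed auto

lemma backup_all:
  "triple n (\<lambda>s. ctx x s \<and> arr 3 n v s \<and> imem s (5, 0, 0) = t) backup_all 500 2
    (\<lambda>s. ctx x s \<and> arr 3 n (backup x v) s \<and> imem s (5, 0, 0) = t)"
  unfolding backup_all_def
proof (rule triple_Seq)
  let ?J = "\<lambda>i s. ctx x s \<and> arr 3 n v s \<and> arr 4 i (backup x v) s \<and> imem s (5, 0, 0) = t"
  show "triple n (\<lambda>s. ctx x s \<and> arr 3 n v s \<and> imem s (5, 0, 0) = t) (For 3 backup_node) 340 2 (?J n)"
  proof (rule triple_For[where J = ?J and T = 320 and k = 1])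
    fix i assume i: "i < n"
    show "triple n (\<lambda>s. ?J i s \<and> imem s (3, 0, 0) = i \<and> imem s (0, 0, 0) = n) backup_node 320 1
      (\<lambda>s. ?J (Suc i) (s\<lparr>imem := (imem s)((3, 0, 0) := Suc i)\<rparr>) \<and>
         imem s (3, 0, 0) = i \<and> imem s (0, 0, 0) = n)"
      by (rule triple_conseq[OF backup_node[OF i, of x v t]]) (auto simp: ctxD)
  qed (auto simp: ctxD)
  let ?K = "\<lambda>i s. ctx x s \<and> arr 4 n (backup x v) s \<and> arr 3 i (backup x v) s \<and> imem s (5, 0, 0) = t"
  show "triple n (?J n) (For 3 (RSet 3 (ivar 3) IZero (RGet 4 (ivar 3) IZero))) 120 1
    (\<lambda>s. ctx x s \<and> arr 3 n (backup x v) s \<and> imem s (5, 0, 0) = t)"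
  proof (rule triple_For[where J = ?K and T = 100 and k = 0])
    fix i assume i: "i < n"
    show "triple n (\<lambda>s. ?K i s \<and> imem s (3, 0, 0) = i \<and> imem s (0, 0, 0) = n)
      (RSet 3 (ivar 3) IZero (RGet 4 (ivar 3) IZero)) 100 0
      (\<lambda>s. ?K (Suc i) (s\<lparr>imem := (imem s)((3, 0, 0) := Suc i)\<rparr>) \<and>
         imem s (3, 0, 0) = i \<and> imem s (0, 0, 0) = n)"
      by (rule triple_RSet) (use i in \<open>auto simp: arrD\<close>)
  qed (auto simp: ctxD)
qed auto

lemma iterate_backup:
  "triple n (\<lambda>s. ctx x s \<and> arr 3 n (backups x 0) s) (For 5 backup_all) 520 3
    (\<lambda>s. ctx x s \<and> arr 3 n (shift x) s)"
proof (rule triple_For[where J = "\<lambda>t s. ctx x s \<and> arr 3 n (backups x t) s" and T = 500 and k = 2])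
  fix t
  show "triple n (\<lambda>s. (ctx x s \<and> arr 3 n (backups x t) s) \<and> imem s (5, 0, 0) = t \<and> imem s (0, 0, 0) = n)
    backup_all 500 2
    (\<lambda>s. (ctx x (s\<lparr>imem := (imem s)((5, 0, 0) := Suc t)\<rparr>) \<and>
        arr 3 n (backups x (Suc t)) (s\<lparr>imem := (imem s)((5, 0, 0) := Suc t)\<rparr>)) \<and>
      imem s (5, 0, 0) = t \<and> imem s (0, 0, 0) = n)"
    by (rule triple_conseq[OF backup_all[of x "backups x t" t]]) (auto simp: ctxD backups_Suc)
qed (auto simp: ctxD shift_def)

definition ratio :: "(nat \<Rightarrow> real) \<Rightarrow> nat \<Rightarrow> nat \<Rightarrow> real" where
  "ratio x a b = sg a * (l * shift x b - shift x a) / slack x a b"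

text \<open>Invariant of the two nested loops of \<open>find_speed\<close>, which scan the edges in
  lexicographic order.\<close>

definition partial_speed :: "(nat \<Rightarrow> real) \<Rightarrow> nat \<Rightarrow> nat \<Rightarrow> real" where
  "partial_speed x i j = Max (insert 0
     ((\<lambda>(a, b). ratio x a b) ` {(a, b) \<in> edges G. a < i \<or> a = i \<and> b < j}))"

lemma partial_speed_0: "partial_speed x 0 0 = 0"
  by (simp add: partial_speed_def)

lemma partial_speed_row: "partial_speed x i n = partial_speed x (Suc i) 0"
proof -
  have "{(a, b) \<in> edges G. a < i \<or> a = i \<and> b < n} = {(a, b) \<in> edges G. a < Suc i \<or> a = Suc i \<and> b < 0}"
    by (auto dest: edge_less)
  then show ?thesis by (simp only: partial_speed_def)
qed

lemma partial_speed_n: "partial_speed x n 0 = speed x"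
proof -
  have "{(a, b) \<in> edges G. a < n \<or> a = n \<and> b < 0} = edges G" by (auto dest: edge_less)
  then show ?thesis by (simp only: partial_speed_def speed_def ratio_def)
qed

lemma partial_speed_Suc:
  "partial_speed x i (Suc j) =
    (if (i, j) \<in> edges G \<and> partial_speed x i j < ratio x i j then ratio x i j else partial_speed x i j)"
proof (cases "(i, j) \<in> edges G")
  case True
  let ?S = "\<lambda>j. {(a, b) \<in> edges G. a < i \<or> a = i \<and> b < j}"
  let ?f = "\<lambda>(a, b). ratio x a b"
  have "finite (?S j)" by (rule finite_subset[OF _ finite_edges]) auto
  moreover have "?S (Suc j) = insert (i, j) (?S j)" using True by (auto simp: less_Suc_eq)
  then have "partial_speed x i (Suc j) = Max (insert (ratio x i j) (insert 0 (?f ` ?S j)))"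
    by (simp only: partial_speed_def image_insert insert_commute prod.case)
  ultimately have "partial_speed x i (Suc j) = max (ratio x i j) (partial_speed x i j)"
    unfolding partial_speed_def by (subst (asm) Max_insert) auto
  then show ?thesis using True by (simp add: max_def)
next
  case False
  then have "{(a, b) \<in> edges G. a < i \<or> a = i \<and> b < Suc j} = {(a, b) \<in> edges G. a < i \<or> a = i \<and> b < j}"
    by (auto simp: less_Suc_eq)
  then show ?thesis using False by (simp add: partial_speed_def)
qed

lemma find_speed:
  "triple n (\<lambda>s. ctx x s \<and> arr 3 n (shift x) s) find_speed 340 2
    (\<lambda>s. ctx x s \<and> arr 3 n (shift x) s \<and> rmem s (5, 0, 0) = speed x)"
  unfolding find_speed_def
proof (rule triple_Seq)
  let ?J = "\<lambda>i s. ctx x s \<and> arr 3 n (shift x) s \<and> rmem s (5, 0, 0) = partial_speed x i 0"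
  show "triple n (\<lambda>s. ctx x s \<and> arr 3 n (shift x) s) (RSet 5 IZero IZero RZero) 100 0 (?J 0)"
    by (rule triple_RSet) (auto simp: partial_speed_0)
  let ?b = "BAnd (ILess IZero (IGet 2 (ivar 3) (ivar 4))) (RLess (RGet 5 IZero IZero) eratio)"
  show "triple n (?J 0) (For 3 (For 4 (Cond ?b (RSet 5 IZero IZero eratio) Skip))) 240 2
    (\<lambda>s. ctx x s \<and> arr 3 n (shift x) s \<and> rmem s (5, 0, 0) = speed x)"
  proof (rule triple_For[where J = ?J and T = 220 and k = 1])
    fix i assume i: "i < n"
    let ?K = "\<lambda>j s. ctx x s \<and> arr 3 n (shift x) s \<and> imem s (3, 0, 0) = i \<and>
      rmem s (5, 0, 0) = partial_speed x i j"
    show "triple n (\<lambda>s. ?J i s \<and> imem s (3, 0, 0) = i \<and> imem s (0, 0, 0) = n)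
      (For 4 (Cond ?b (RSet 5 IZero IZero eratio) Skip)) 220 1
      (\<lambda>s. ?J (Suc i) (s\<lparr>imem := (imem s)((3, 0, 0) := Suc i)\<rparr>) \<and>
         imem s (3, 0, 0) = i \<and> imem s (0, 0, 0) = n)"
    proof (rule triple_For[where J = ?K and T = 200 and k = 0])
      fix j assume j: "j < n"
      let ?P = "\<lambda>s. ?K j s \<and> imem s (4, 0, 0) = j \<and> imem s (0, 0, 0) = n"
      let ?Q = "\<lambda>s. ?K (Suc j) (s\<lparr>imem := (imem s)((4, 0, 0) := Suc j)\<rparr>) \<and>
         imem s (4, 0, 0) = j \<and> imem s (0, 0, 0) = n"
      have r: "rval eratio s = ratio x i j" if "?P s" "(i, j) \<in> edges G" for s
        using that i j by (elim conjE) (simp only: rval.simps ival.simps ctxD arrD ratio_def slack_def One_nat_def if_True)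
      have b: "bval ?b s \<longleftrightarrow> (i, j) \<in> edges G \<and> partial_speed x i j < ratio x i j" if "?P s" for s
        using that i j r[OF that] by (auto simp: ctxD simp del: rval.simps(7))
      show "triple n ?P (Cond ?b (RSet 5 IZero IZero eratio) Skip) 200 0 ?Q"
      proof (rule triple_Cond)
        show "triple n (\<lambda>s. ?P s \<and> bval ?b s) (RSet 5 IZero IZero eratio) 60 0 ?Q"
        proof (rule triple_RSet)
          fix s assume s: "?P s \<and> bval ?b s"
          then have e: "(i, j) \<in> edges G" and q: "partial_speed x i (Suc j) = ratio x i j"
            using b[of s] by (simp_all only: partial_speed_Suc) simp_all
          have "rval eratio s = partial_speed x i (Suc j)" using r[of s] s e q by simp
          then show "?Q (s\<lparr>rmem := (rmem s)((5, ival IZero s, ival IZero s) := rval eratio s)\<rparr>)"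
            using s by (simp del: bval.simps rval.simps)
        qed (use i j in auto)
        show "triple n (\<lambda>s. ?P s \<and> \<not> bval ?b s) Skip 60 0 ?Q"
        proof (rule triple_Skip)
          fix s assume s: "?P s \<and> \<not> bval ?b s"
          then have "partial_speed x i (Suc j) = partial_speed x i j"
            using b[of s] by (simp only: partial_speed_Suc) simp
          then show "?Q s" using s by (simp del: bval.simps)
        qed simp
      qed (use i j in auto)
    qed (auto simp: ctxD partial_speed_row)
  qed (auto simp: ctxD partial_speed_n)
qed auto

text \<open>Updating in place is safe, since the new value of a node uses no other entry of array 2.
  The speed stays in its cell for the loop test.\<close>

lemma move_point:
  "triple n (\<lambda>s. ctx x s \<and> arr 3 n (shift x) s \<and> rmem s (5, 0, 0) = speed x) move_point 120 1
    (\<lambda>s. ctx (move x) s \<and> rmem s (5, 0, 0) = speed x)"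
  unfolding move_point_def
proof (rule triple_For[where T = 100 and k = 0 and J = "\<lambda>i s. inp s \<and> arr 6 n sg s \<and> arr 3 n (shift x) s \<and>
    rmem s (5, 0, 0) = speed x \<and> (\<forall>a. rmem s (2, a, 0) = (if a < i then move x a else x a))"])
  let ?J = "\<lambda>i s. inp s \<and> arr 6 n sg s \<and> arr 3 n (shift x) s \<and>
    rmem s (5, 0, 0) = speed x \<and> (\<forall>a. rmem s (2, a, 0) = (if a < i then move x a else x a))"
  fix i assume i: "i < n"
  show "triple n (\<lambda>s. ?J i s \<and> imem s (3, 0, 0) = i \<and> imem s (0, 0, 0) = n)
    (RSet 2 (ivar 3) IZero (RAdd (RGet 2 (ivar 3) IZero)
     (RDiv (RGet 3 (ivar 3) IZero) (RGet 5 IZero IZero)))) 100 0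
    (\<lambda>s. ?J (Suc i) (s\<lparr>imem := (imem s)((3, 0, 0) := Suc i)\<rparr>) \<and>
       imem s (3, 0, 0) = i \<and> imem s (0, 0, 0) = n)"
    by (rule triple_RSet) (use i in \<open>auto simp: arrD move_def less_Suc_eq\<close>)
next
  fix s assume "inp s \<and> arr 6 n sg s \<and> arr 3 n (shift x) s \<and>
    rmem s (5, 0, 0) = speed x \<and> (\<forall>a. rmem s (2, a, 0) = (if a < n then move x a else x a))"
  then show "ctx (move x) s \<and> rmem s (5, 0, 0) = speed x"
    by (auto simp: ctx_mem_def col_mem_def move_def shift_outside fun_eq_iff)
qed (auto simp: ctx_mem_def inpD col_mem_def)

text \<open>The degree 3 comes from \<open>n\<close> rounds of a backup over all pairs of nodes;
  1100 is 120 + 520 + 340 + 120.\<close>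

lemma main_body: "triple n (ctx x) main_body 1100 3 (\<lambda>s. ctx (move x) s \<and> rmem s (5, 0, 0) = speed x)"
  unfolding main_body_def
  by (rule triple_Seq[OF zero_shift triple_Seq[OF iterate_backup triple_Seq[OF find_speed move_point,
        where V = 460 and j = 2], where V = 980 and j = 3]]) auto

section \<open>The main loop and the total cost\<close>

lemma feasible_cong:
  assumes "\<And>a. a < n \<Longrightarrow> x a = y a"
  shows "feasible x \<longleftrightarrow> feasible y"
proof -
  have "slack x a b = slack y a b" if "(a, b) \<in> edges G" for a b
    using assms edge_less[OF that] by (simp add: slack_def)
  then show ?thesis by (auto simp: feasible_def)
qed

lemma main_loop:
  assumes "inp s" "arr 6 n sg s" "arr 2 n start s" "rmem s (5, 0, 0) = 1"
  shows "\<exists>\<tau> F t. exec (While (RLess RZero (RGet 5 IZero IZero)) main_body) s \<tau> F t \<and>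
    \<tau> \<le> (card (profiles n) + 2) * (1100 * (n + 1) ^ 3 + 6) \<and> F \<subseteq> cells n \<and>
    (\<forall>a<n. rmem t (2, a, 0) = value_vector G a)"
proof -
  let ?b = "RLess RZero (RGet 5 IZero IZero)"
  \<comment> \<open>After a pass the cell \<open>(5, 0, 0)\<close> holds the speed before the move.
    Only speed 0 must carry over to the current point, and it does, because that move changes
    nothing. Initially the cell is 1 and the clause is vacuous.\<close>
  define I where "I s \<longleftrightarrow> ctx (col 2 s) s \<and> feasible (col 2 s) \<and>
    (rmem s (5, 0, 0) \<le> 0 \<longrightarrow> speed (col 2 s) = 0)" for s :: state
  \<comment> \<open>The added 1 pays for the pass that discovers speed 0: it keeps the rank but
    sends the measure to 0.\<close>
  define m where "m s = (if 0 < rmem s (5, 0, 0) then rank (col 2 s) + 1 else 0)" for s :: state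
  have "feasible start \<longleftrightarrow> feasible (col 2 s)"
    by (rule feasible_cong) (use assms(3) in \<open>simp add: arr_mem_def col_mem_def\<close>)
  then have I: "I s" using assms feasible_start by (simp add: I_def ctx_mem_def start_def[abs_def])
  have body: "triple n (\<lambda>s. I s \<and> bval ?b s \<and> m s = i) main_body 1100 3 (\<lambda>s. I s \<and> m s < i)" for i
    unfolding triple_def
  proof (intro allI impI)
    fix s assume s: "I s \<and> bval ?b s \<and> m s = i"
    let ?x = "col 2 s"
    have ctx: "ctx ?x s" and feas: "feasible ?x" and m: "i = rank ?x + 1" using s by (auto simp: I_def m_def)
    obtain \<tau> F t where 1: "exec main_body s \<tau> F t" "\<tau> \<le> 1100 * (n + 1) ^ 3" "F \<subseteq> cells n"
      "ctx (move ?x) t \<and> rmem t (5, 0, 0) = speed ?x"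
      by (rule tripleD[OF main_body ctx])
    have t: "col 2 t = move ?x" using 1(4) by (simp add: ctx_mem_def)
    have "move ?x = ?x" if "speed ?x = 0" using that by (simp add: move_def fun_eq_iff)
    then have "I t" using 1(4) t feas feasible_move speed_nonneg[of ?x] by (auto simp: I_def)
    moreover have "m t < i" using rank_move[of ?x] feas t m 1(4) by (simp add: m_def)
    ultimately show "\<exists>\<tau> F t. exec main_body s \<tau> F t \<and> \<tau> \<le> 1100 * (n + 1) ^ 3 \<and> F \<subseteq> cells n \<and>
      I t \<and> m t < i" using 1 by blast
  qed
  have "\<exists>\<tau> F t. exec (While ?b main_body) s \<tau> F t \<and>
    \<tau> \<le> (m s + 1) * (1100 * (n + 1) ^ 3 + btime ?b + 1) \<and> F \<subseteq> cells n \<and> I t \<and> \<not> bval ?b t"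
    by (rule exec_While_measure[OF body _ I]) simp
  then obtain \<tau> F t where 1: "exec (While ?b main_body) s \<tau> F t"
    "\<tau> \<le> (m s + 1) * (1100 * (n + 1) ^ 3 + btime ?b + 1)" "F \<subseteq> cells n" "I t" "\<not> bval ?b t"
    by blast
  have "(m s + 1) * (1100 * (n + 1) ^ 3 + btime ?b + 1)
      \<le> (card (profiles n) + 2) * (1100 * (n + 1) ^ 3 + 6)"
    using rank_le[of "col 2 s"] by (intro mult_le_mono) (simp_all add: m_def)
  then have "\<tau> \<le> (card (profiles n) + 2) * (1100 * (n + 1) ^ 3 + 6)" using 1(2) by linarith
  moreover have "rmem t (2, a, 0) = value_vector G a" if "a < n" for a
  proof -
    have "speed (col 2 t) = 0" "feasible (col 2 t)" using 1(4,5) by (auto simp: I_def)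
    then have "value_vector G a = col 2 t a"
      using value_vector_eqI[OF _ _ that] speed_0_tight by blast
    then show ?thesis by (simp add: col_mem_def)
  qed
  ultimately show ?thesis using 1 by blast
qed

lemma inp_game_input: "inp (game_input G)"
  by (auto simp: input_mem_def game_input_def)

text \<open>The degree 4 is 3 for a pass and 1 for the factor \<open>n + 1\<close> in the number of
  profiles. The constant covers 3318 for the loop and 580 for the initialisation; the space is at
  most \<open>card (cells n)\<close>, which is quadratic.\<close>

lemma program_correct:
  "\<exists>\<tau> F t. exec program (game_input G) \<tau> F t \<and> (\<forall>a\<in>nodes G. game_output t a = value_vector G a) \<and>
     real \<tau> \<le> real (5000 * (n + 1) ^ 4) * (2 + sqrt 2) ^ n \<and>
     finite F \<and> card F \<le> 5000 * (n + 1) ^ 4"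
proof -
  let ?while = "While (RLess RZero (RGet 5 IZero IZero)) main_body"
  obtain \<tau>1 F1 s1 where 1: "exec init_signs (game_input G) \<tau>1 F1 s1" "\<tau>1 \<le> 120 * (n + 1) ^ 1"
    "F1 \<subseteq> cells n" "inp s1 \<and> arr 6 n sg s1"
    by (rule tripleD[OF init_signs inp_game_input])
  obtain \<tau>2 F2 s2 where 2: "exec init_bound s1 \<tau>2 F2 s2" "\<tau>2 \<le> 240 * (n + 1) ^ 2"
    "F2 \<subseteq> cells n" "inp s2 \<and> arr 6 n sg s2 \<and> rmem s2 (5, 0, 0) = bound"
    by (rule tripleD[OF init_bound 1(4)])
  obtain \<tau>3 F3 s3 where 3: "exec init_point s2 \<tau>3 F3 s3" "\<tau>3 \<le> 220 * (n + 1) ^ 1"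
    "F3 \<subseteq> cells n" "inp s3 \<and> arr 6 n sg s3 \<and> arr 2 n start s3 \<and> rmem s3 (5, 0, 0) = 1"
    by (rule tripleD[OF init_point 2(4)])
  obtain \<tau>4 F4 t where 4: "exec ?while s3 \<tau>4 F4 t"
    "\<tau>4 \<le> (card (profiles n) + 2) * (1100 * (n + 1) ^ 3 + 6)"
    "F4 \<subseteq> cells n" "\<forall>a<n. rmem t (2, a, 0) = value_vector G a"
    using main_loop[of s3] 3(4) by blast
  let ?\<tau> = "\<tau>1 + (\<tau>2 + (\<tau>3 + \<tau>4))" and ?F = "F1 \<union> (F2 \<union> (F3 \<union> F4))"
  have ex: "exec program (game_input G) ?\<tau> ?F t"
    unfolding program_def by (intro exec.Seq[OF 1(1)] exec.Seq[OF 2(1)] exec.Seq[OF 3(1)] 4(1))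
  have F: "?F \<subseteq> cells n" using 1(3) 2(3) 3(3) 4(3) by blast
  have fin: "finite (cells n)" by (simp add: cells_def)
  have "card ?F \<le> 14 * (n + 1) ^ 2" using card_mono[OF fin F] card_cells[of n] by linarith
  also have "\<dots> \<le> 5000 * (n + 1) ^ 4" by (rule time_mono) auto
  finally have card: "card ?F \<le> 5000 * (n + 1) ^ 4" .
  define N where "N = real (n + 1)"
  define B where "B = (2 + sqrt 2) ^ n"
  have N: "1 \<le> N" by (simp add: N_def)
  have B: "1 \<le> B" unfolding B_def by (intro one_le_power) (simp add: add_increasing2)
  have pw: "N ^ i \<le> N ^ j" if "i \<le> j" for i j using that N by (rule power_increasing)
  have "real (card (profiles n) + 2) \<le> 3 * (N * B)"
  proof -
    have "1 \<le> N * B" using mult_mono[OF N B] N by simp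
    then show ?thesis using card_profiles_bound[of n] by (simp add: N_def B_def add.commute)
  qed
  moreover have "real (1100 * (n + 1) ^ 3 + 6) \<le> 1106 * N ^ 3"
  proof -
    have "real (1100 * (n + 1) ^ 3 + 6) = 1100 * N ^ 3 + 6" by (simp add: N_def)
    then show ?thesis using one_le_power[OF N, of 3] by linarith
  qed
  ultimately have prod: "real (card (profiles n) + 2) * real (1100 * (n + 1) ^ 3 + 6)
      \<le> (3 * (N * B)) * (1106 * N ^ 3)"
    using N B by (intro mult_mono) auto
  have "real \<tau>4 \<le> real ((card (profiles n) + 2) * (1100 * (n + 1) ^ 3 + 6))"
    using 4(2) by (simp only: of_nat_le_iff)
  also have "\<dots> = real (card (profiles n) + 2) * real (1100 * (n + 1) ^ 3 + 6)"
    by (rule of_nat_mult)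
  also note prod
  also have "(3 * (N * B)) * (1106 * N ^ 3) = 3318 * (N ^ 4 * B)" by (simp add: power_numeral_reduce)
  finally have t4: "real \<tau>4 \<le> 3318 * (N ^ 4 * B)" .
  have "\<tau>1 + (\<tau>2 + \<tau>3) \<le> 580 * (n + 1) ^ 4"
    using 1(2) 2(2) 3(2) time_mono[of 120 120 1 4 n] time_mono[of 240 240 2 4 n]
      time_mono[of 220 220 1 4 n] by linarith
  then have "real (\<tau>1 + (\<tau>2 + \<tau>3)) \<le> real (580 * (n + 1) ^ 4)" by (simp only: of_nat_le_iff)
  also have "\<dots> = 580 * N ^ 4" by (simp add: N_def)
  also have "\<dots> \<le> 580 * (N ^ 4 * B)" using B N by simp
  finally have "real ?\<tau> \<le> 5000 * (N ^ 4 * B)"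
    using t4 B N by simp
  then have "real ?\<tau> \<le> real (5000 * (n + 1) ^ 4) * (2 + sqrt 2) ^ n" by (simp add: N_def B_def)
  then show ?thesis
    using ex 4(4) card finite_subset[OF F fin]
    by (intro exI[of _ ?\<tau>] exI[of _ ?F] exI[of _ t]) (simp add: nodes_def game_output_def)
qed

end

theorem theorem1:
  shows "\<exists>(P :: com) (K :: nat) (k :: nat). \<forall>G. discounted_game G \<longrightarrow>
    (\<exists>\<tau> F t. exec P (game_input G) \<tau> F t \<and>
       (\<forall>a\<in>nodes G. game_output t a = value_vector G a) \<and>
       real \<tau> \<le> real (K * (num_nodes G + 1) ^ k) * (2 + sqrt 2) ^ num_nodes G \<and>
       finite F \<and> card F \<le> K * (num_nodes G + 1) ^ k)"
proof (rule exI[of _ program], rule exI[of _ 5000], rule exI[of _ 4], intro allI impI)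
  fix G assume "discounted_game G"
  then interpret game G by unfold_locales
  show "\<exists>\<tau> F t. exec program (game_input G) \<tau> F t \<and>
       (\<forall>a\<in>nodes G. game_output t a = value_vector G a) \<and>
       real \<tau> \<le> real (5000 * (num_nodes G + 1) ^ 4) * (2 + sqrt 2) ^ num_nodes G \<and>
       finite F \<and> card F \<le> 5000 * (num_nodes G + 1) ^ 4"
    by (rule program_correct)
qed

end
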